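(* Let $D$ be a $k$-partite tournament with $k$-partition $(V_1,\ldots,V_k)$ and ordered strong components $Q_1,\ldots,Q_s$. When $D$ has a nontrivial strong component, let $Q_t$ be the last nontrivial component, and assume that the partite sets $V_i$ and the sets of imprimitivity $U_i^{(t)}$ of $Q_t$ are labeled according to the labeling convention stated in the context. Then the graph sequence $\{C^m(D)\}_{m=1}^{\infty}$ diverges if and only if all of the following hold: (a) $s\ge 2$; (b) $D$ has a nontrivial strong component; (c) for the last nontrivial component $Q_t$, $t<s$; and (d) one of the following is true: (i) $\kappa(Q_t)=3$ and $\bigcup_{i=t+1}^{s}V(Q_i)\subseteq V_j$ for some $j\in\{1,2,3\}$; (ii) $\kappa(Q_t)=3$ and there is an integer $\alpha\in\{t+1,\ldots,s-1\}$ such that $V(D_{t+1\sim\alpha})$ and $V(D_{\alpha+1\sim s})$ are partite-related to $U_j^{(t)}$ and $U_{j+1}^{(t)}$, respectively, for some integer $j\in\{1,2,3\}$ (identifying $U_4^{(t)}$ with $U_1^{(t)}$); (iii) $\kappa(Q_t)=4$ and $\bigcup_{i=t+1}^{s}V(Q_i)\subseteq V_j$ for some $j\in\{1,2\}$.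
   Context: All digraphs are finite with simple underlying graph. For a positive integer $m$, the $m$-step competition graph $C^m(D)$ of a digraph $D$ is the simple graph with vertex set $V(D)$ in which two distinct vertices $u,v$ are adjacent iff there is a vertex $w$ such that there are directed walks of length exactly $m$ from $u$ to $w$ and from $v$ to $w$. The sequence $\{C^m(D)\}_{m=1}^\infty$ converges to a graph $G$ if $C^m(D)=G$ for all sufficiently large $m$; it diverges if it does not converge. A $k$-partite tournament ($k$ a positive integer) is an orientation of a complete $k$-partite graph; its $k$-partition $(V_1,\dots,V_k)$ consists of its (nonempty) partite sets. Ordered strong components of $D$ are its strong components arranged as $Q_1,\ldots,Q_s$ so that there is no arc from $Q_i$ to $Q_j$ whenever $i>j$. A strong component is trivial if it has exactly one vertex and nontrivial otherwise. The last nontrivial component is the nontrivial $Q_t$ such that $Q_i$ is trivial for every $t<i\le s$. $D_{\alpha\sim\beta}$ denotes the subdigraph of $D$ induced by $\bigcup_{i=\alpha}^{\beta}V(Q_i)$. A vertex set $X$ is partite-related to a vertex set $Y$ if $X\subseteq W$ and $Y\subseteq W$ for some partite set $W$ of $D$. For a nontrivial strongly connected digraph $Q$, the index of imprimitivity $\kappa(Q)$ is the greatest common divisor of the lengths of its closed directed walks. The sets of imprimitivity of $Q$ are the nonempty sets $U_1,\dots,U_{\kappa(Q)}$ partitioning $V(Q)$ such that each arc of $Q$ goes from $U_i$ to $U_{i+1}$ for some $i$ (with $U_{\kappa(Q)+1}=U_1$). Those of $Q_t$ are denoted $U_1^{(t)},\dots,U_{\kappa(Q_t)}^{(t)}$.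 Labeling convention (it is known that such a labeling is always possible): if $\kappa(Q_t)=2$, then $V_i\cap V(Q_t)=U_i^{(t)}$ for $i=1,2$, and $V(Q_t)\subseteq V_1\cup V_2$; if $\kappa(Q_t)=3$, then $V_i\cap V(Q_t)=U_i^{(t)}$ for $i=1,2,3$, and $V(Q_t)\subseteq V_1\cup V_2\cup V_3$; if $\kappa(Q_t)=4$, then $V_i\cap V(Q_t)=U_i^{(t)}\cup U_{i+2}^{(t)}$ for $i=1,2$, and $V(Q_t)\subseteq V_1\cup V_2$. *)

theory Defs
  imports "Graph_Theory.Graph_Theory"
begin

text \<open>
  Following \<^theory>\<open>Graph_Theory.Digraph\<close>, a simple undirected graph is represented by a symmetric
  loop-free set of ordered pairs, as a \<^typ>\<open>'a pair_pre_digraph\<close>.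
\<close>

definition step_competition_graph :: "nat \<Rightarrow> ('a, 'b) pre_digraph \<Rightarrow> 'a pair_pre_digraph" where
  "step_competition_graph m D =
     \<lparr> pverts = verts D,
       parcs = {(u, v). u \<in> verts D \<and> v \<in> verts D \<and> u \<noteq> v \<and>
         (\<exists>w p q. pre_digraph.awalk D u p w \<and> length p = m \<and>
                  pre_digraph.awalk D v q w \<and> length q = m)} \<rparr>"

definition graph_seq_converges_to :: "(nat \<Rightarrow> 'a pair_pre_digraph) \<Rightarrow> 'a pair_pre_digraph \<Rightarrow> bool" where
  "graph_seq_converges_to S G \<longleftrightarrow> (\<exists>N. \<forall>m\<ge>N. S m = G)"

definition graph_seq_diverges :: "(nat \<Rightarrow> 'a pair_pre_digraph) \<Rightarrow> bool" where
  "graph_seq_diverges S \<longleftrightarrow> \<not> (\<exists>G. graph_seq_converges_to S G)"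

text \<open>Families of sets with \<open>n\<close> members are functions on \<open>nat\<close>, relevant on \<open>{1..n}\<close> only.\<close>

definition is_partition_of :: "(nat \<Rightarrow> 'a set) \<Rightarrow> nat \<Rightarrow> 'a set \<Rightarrow> bool" where
  "is_partition_of V n A \<longleftrightarrow>
     (\<forall>i\<in>{1..n}. V i \<noteq> {}) \<and> disjoint_family_on V {1..n} \<and> (\<Union>i\<in>{1..n}. V i) = A"

definition complete_multipartite_graph ::
    "nat \<Rightarrow> (nat \<Rightarrow> 'a set) \<Rightarrow> 'a pair_pre_digraph \<Rightarrow> bool" where
  "complete_multipartite_graph k V G \<longleftrightarrow>
     is_partition_of V k (pverts G) \<and>
     parcs G = {(u, v). \<exists>i\<in>{1..k}. \<exists>j\<in>{1..k}. i \<noteq> j \<and> u \<in> V i \<and> v \<in> V j}"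

text \<open>
  \<^const>\<open>mk_symmetric\<close> forgets the direction of arcs but also merges opposite ones, so asymmetry is
  required separately: exactly one direction of each edge is chosen.
\<close>

definition orientation_of :: "('a, 'b) pre_digraph \<Rightarrow> 'a pair_pre_digraph \<Rightarrow> bool" where
  "orientation_of D G \<longleftrightarrow> digraph D \<and> asym (arcs_ends D) \<and> mk_symmetric D = G"

definition multipartite_tournament ::
    "nat \<Rightarrow> (nat \<Rightarrow> 'a set) \<Rightarrow> ('a, 'b) pre_digraph \<Rightarrow> bool" where
  "multipartite_tournament k V D \<longleftrightarrow>
     1 \<le> k \<and> (\<exists>G. complete_multipartite_graph k V G \<and> orientation_of D G)"

definition partite_related :: "nat \<Rightarrow> (nat \<Rightarrow> 'a set) \<Rightarrow> 'a set \<Rightarrow> 'a set \<Rightarrow> bool" where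
  "partite_related k V X Y \<longleftrightarrow> (\<exists>l\<in>{1..k}. X \<subseteq> V l \<and> Y \<subseteq> V l)"

definition ordered_strong_components ::
    "('a, 'b) pre_digraph \<Rightarrow> nat \<Rightarrow> (nat \<Rightarrow> ('a, 'b) pre_digraph) \<Rightarrow> bool" where
  "ordered_strong_components D s Q \<longleftrightarrow>
     bij_betw Q {1..s} (pre_digraph.sccs D) \<and>
     (\<forall>i\<in>{1..s}. \<forall>j\<in>{1..s}. i > j \<longrightarrow>
        \<not> (\<exists>u\<in>verts (Q i). \<exists>v\<in>verts (Q j). u \<rightarrow>\<^bsub>D\<^esub> v))"

definition nontrivial_component :: "('a, 'b) pre_digraph \<Rightarrow> bool" where
  "nontrivial_component C \<longleftrightarrow> card (verts C) \<noteq> 1"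

definition last_nontrivial_component ::
    "nat \<Rightarrow> (nat \<Rightarrow> ('a, 'b) pre_digraph) \<Rightarrow> nat \<Rightarrow> bool" where
  "last_nontrivial_component s Q t \<longleftrightarrow>
     t \<in> {1..s} \<and> nontrivial_component (Q t) \<and>
     (\<forall>i. t < i \<and> i \<le> s \<longrightarrow> \<not> nontrivial_component (Q i))"

definition component_range ::
    "('a, 'b) pre_digraph \<Rightarrow> (nat \<Rightarrow> ('a, 'b) pre_digraph) \<Rightarrow> nat \<Rightarrow> nat \<Rightarrow> ('a, 'b) pre_digraph" where
  "component_range D Q \<alpha> \<beta> = D \<restriction> (\<Union>i\<in>{\<alpha>..\<beta>}. verts (Q i))"

definition imprimitivity_index :: "('a, 'b) pre_digraph \<Rightarrow> nat" where
  "imprimitivity_index C = Gcd {length p | p. wf_digraph.closed_w C p}"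

text \<open>
  On \<open>{1..n}\<close>, the map \<open>i \<mapsto> i mod n + 1\<close> is the cyclic successor, sending \<open>n\<close> to \<open>1\<close>.
\<close>

definition sets_of_imprimitivity :: "('a, 'b) pre_digraph \<Rightarrow> (nat \<Rightarrow> 'a set) \<Rightarrow> bool" where
  "sets_of_imprimitivity C U \<longleftrightarrow>
     is_partition_of U (imprimitivity_index C) (verts C) \<and>
     (\<forall>u v. u \<rightarrow>\<^bsub>C\<^esub> v \<longrightarrow>
        (\<exists>i\<in>{1..imprimitivity_index C}.
           u \<in> U i \<and> v \<in> U (i mod imprimitivity_index C + 1)))"

definition labeling_convention ::
    "(nat \<Rightarrow> 'a set) \<Rightarrow> ('a, 'b) pre_digraph \<Rightarrow> (nat \<Rightarrow> 'a set) \<Rightarrow> bool" where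
  "labeling_convention V C U \<longleftrightarrow>
     (imprimitivity_index C = 2 \<longrightarrow>
        (\<forall>i\<in>{1,2}. V i \<inter> verts C = U i) \<and> verts C \<subseteq> V 1 \<union> V 2) \<and>
     (imprimitivity_index C = 3 \<longrightarrow>
        (\<forall>i\<in>{1,2,3}. V i \<inter> verts C = U i) \<and> verts C \<subseteq> V 1 \<union> V 2 \<union> V 3) \<and>
     (imprimitivity_index C = 4 \<longrightarrow>
        (\<forall>i\<in>{1,2}. V i \<inter> verts C = U i \<union> U (i + 2)) \<and> verts C \<subseteq> V 1 \<union> V 2)"

end

theory Submission
  imports Defs
begin

text \<open>
  Let \<open>C\<close> be the last nontrivial component and \<open>T\<close> the set of vertices after it. Walks starting in \<open>T\<close>
  have bounded length, and every vertex outside \<open>T\<close> has an out-neighbour in \<open>C\<close>. Hence a common prey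
  outside \<open>T\<close> can be prolonged forever, and the adjacency of two vertices can only oscillate if all
  their common preys lie in \<open>T\<close>. The index of imprimitivity of \<open>C\<close> is at most 4. If it is 1 or 2, two
  vertices of \<open>C\<close> in the same class have a common prey in \<open>C\<close>. If it is 3 or 4, a vertex \<open>w\<close> of \<open>T\<close> is
  dominated by all classes of \<open>C\<close> outside the partite set of \<open>w\<close>; moving two core vertices of different
  classes along, one sees in which phases such a \<open>w\<close> serves both. The sequence diverges exactly if, for
  some pair, some phases are served and others are not, which is the case in (i)--(iii) only.
\<close>

text \<open>Adjacency in the competition graph, freed from vertex membership and distinctness, so
  that a walk of length \<open>m\<close> is just a pair in \<open>R ^^ m\<close>.\<close>

definition share_prey :: "'a rel \<Rightarrow> nat \<Rightarrow> 'a \<Rightarrow> 'a \<Rightarrow> bool" where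
  "share_prey R m u v \<longleftrightarrow> (\<exists>w. (u, w) \<in> R ^^ m \<and> (v, w) \<in> R ^^ m)"

lemma share_preyI: "(u, w) \<in> R ^^ m \<Longrightarrow> (v, w) \<in> R ^^ m \<Longrightarrow> share_prey R m u v"
  by (auto simp: share_prey_def)

lemma share_prey_commute: "share_prey R m u v = share_prey R m v u"
  by (auto simp: share_prey_def)

text \<open>Over finitely many vertices, the graph sequence diverges exactly if the adjacency of
  some pair of distinct vertices behaves like this.\<close>

definition oscillates :: "(nat \<Rightarrow> bool) \<Rightarrow> bool" where
  "oscillates P \<longleftrightarrow> (\<exists>\<^sub>\<infinity>n. P n) \<and> (\<exists>\<^sub>\<infinity>n. \<not> P n)"

text \<open>The usual way to convergence: one occurrence already forces \<open>P\<close> from some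
  point on, and without any occurrence \<open>P\<close> is constantly false.\<close>

lemma not_oscillatesI:
  assumes "\<And>m. P m \<Longrightarrow> \<forall>\<^sub>\<infinity>n. P n"
  shows "\<not> oscillates P"
proof
  assume "oscillates P"
  then obtain m where "P m" "\<not> (\<forall>\<^sub>\<infinity>n. P n)"
    by (auto simp: oscillates_def dest: INFM_EX)
  then show False using assms by blast
qed

lemma not_oscillates_if_MOST: "\<forall>\<^sub>\<infinity>n. P n \<Longrightarrow> \<not> oscillates P"
  using not_oscillatesI by blast

text \<open>Below, \<open>p\<close> is the class of a starting core vertex and \<open>p + n\<close>
  its phase after \<open>n\<close> steps. \<open>Suc n\<close> allows for one more step from the
  core into the tail.\<close>

lemma oscillates_if_residues:
  fixes k :: nat
  assumes "k > 0"
    and "\<And>n. (p + n) mod k = a mod k \<Longrightarrow> P (Suc n)"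
    and "\<And>n. (p + n) mod k = b mod k \<Longrightarrow> \<not> P n"
  shows "oscillates P"
proof -
  have hit: "\<exists>n\<ge>N. (p + n) mod k = c mod k" for N c
  proof (intro exI conjI)
    \<comment> \<open>The summand \<open>(k - 1) * p\<close> completes \<open>p\<close> to a
      multiple of \<open>k\<close>, and \<open>k * N\<close> pushes the witness beyond
      \<open>N\<close>.\<close>
    have "p + (c + (k - 1) * p + k * N) = c + k * (p + N)"
      using assms(1) by (cases k) (auto simp: algebra_simps)
    then show "(p + (c + (k - 1) * p + k * N)) mod k = c mod k"
      by (metis mod_mult_self2)
    have "N \<le> k * N" using assms(1) by simp
    then show "N \<le> c + (k - 1) * p + k * N" by linarith
  qed
  have "\<exists>n\<ge>N. P n" for N
    using hit[of N a] assms(2) by (meson le_SucI)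
  moreover have "\<exists>n\<ge>N. \<not> P n" for N
    using hit[of N b] assms(3) by blast
  ultimately show ?thesis by (auto simp: oscillates_def INFM_nat_le)
qed

text \<open>Two walks that start \<open>c\<close> classes apart stay \<open>c\<close> apart,
  whatever the number of steps.\<close>

lemma mod_shift:
  fixes k :: nat
  assumes "y mod k = (x + c) mod k" "(x + n) mod k = d mod k"
  shows "(y + n) mod k = (d + c) mod k"
proof -
  have "(y + n) mod k = ((x + c) + n) mod k" using assms(1) by (rule mod_add_cong) simp
  also have "\<dots> = ((x + n) + c) mod k" by (simp add: ac_simps)
  also have "\<dots> = (d + c) mod k" using assms(2) by (rule mod_add_cong) simp
  finally show ?thesis .
qed

lemma odd_mod_4_iff: "odd (n :: nat) \<longleftrightarrow> odd (n mod 4)"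
  by presburger

section \<open>Differences of closed walk lengths\<close>

lemma relpow_trans_add: "(x, y) \<in> R ^^ m \<Longrightarrow> (y, z) \<in> R ^^ n \<Longrightarrow> (x, z) \<in> R ^^ (m + n)"
  by (auto simp: relpow_add)

lemma relpow_subset: "(R :: 'a rel) \<subseteq> S \<Longrightarrow> R ^^ n \<subseteq> S ^^ n"
  by (induction n) (simp_all add: relcomp_mono)

text \<open>The differences of lengths of closed walks at \<open>x\<close> are closed under sums and
  nonnegative differences, so they are the multiples of the least positive one, if there is one. A
  closed walk anywhere in \<open>C\<close> yields such a difference by a detour from
  \<open>x\<close>, so the least one divides the Gcd and hence \<open>d\<close>.\<close>

lemma Gcd_dvd_imp_closed_walk_difference:
  fixes S :: "'a rel"
  assumes strong: "\<And>x y. x \<in> C \<Longrightarrow> y \<in> C \<Longrightarrow> (x, y) \<in> S\<^sup>*"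
    and S: "S \<subseteq> C \<times> C" and x: "x \<in> C"
    and d: "Gcd {n. 0 < n \<and> (\<exists>u. (u, u) \<in> S ^^ n)} dvd d"
  shows "\<exists>n. (x, x) \<in> S ^^ (n + d) \<and> (x, x) \<in> S ^^ n"
proof -
  define P where "P a \<longleftrightarrow> (\<exists>n. (x, x) \<in> S ^^ (n + a) \<and> (x, x) \<in> S ^^ n)" for a
  have P0: "P 0" unfolding P_def by (rule exI[of _ 0]) simp
  have P_add: "P (a + b)" if "P a" "P b" for a b
  proof -
    obtain m n where "(x, x) \<in> S ^^ (m + a)" "(x, x) \<in> S ^^ m" "(x, x) \<in> S ^^ (n + b)" "(x, x) \<in> S ^^ n"
      using \<open>P a\<close> \<open>P b\<close> unfolding P_def by auto
    then have "(x, x) \<in> S ^^ ((m + a) + (n + b))" "(x, x) \<in> S ^^ (m + n)"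
      by (blast intro: relpow_trans_add)+
    then show ?thesis unfolding P_def by (intro exI[of _ "m + n"]) (simp add: ac_simps)
  qed
  have P_diff: "P (a - b)" if "P a" "P b" "b \<le> a" for a b
  proof -
    obtain m n where "(x, x) \<in> S ^^ (m + a)" "(x, x) \<in> S ^^ m" "(x, x) \<in> S ^^ (n + b)" "(x, x) \<in> S ^^ n"
      using \<open>P a\<close> \<open>P b\<close> unfolding P_def by auto
    then have "(x, x) \<in> S ^^ ((m + a) + n)" "(x, x) \<in> S ^^ (m + (n + b))"
      by (blast intro: relpow_trans_add)+
    moreover have "(m + a) + n = (m + (n + b)) + (a - b)" using \<open>b \<le> a\<close> by simp
    ultimately show ?thesis unfolding P_def by (intro exI[of _ "m + (n + b)"]) simp
  qed
  have P_mult: "P (q * g)" if "P g" for q g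
    using that by (induction q) (auto simp: P0 intro: P_add)
  have P_closed: "P n" if "0 < n" and u: "(u, u) \<in> S ^^ n" for n u
  proof -
    have "u \<in> C"
      using that S by (metis SigmaE mem_Sigma_iff relpow_E2 not_gr_zero subsetD)
    then obtain a b where "(x, u) \<in> S ^^ a" "(u, x) \<in> S ^^ b"
      using strong x by (meson rtrancl_imp_relpow)
    then have "(x, x) \<in> S ^^ (a + b)" "(x, x) \<in> S ^^ ((a + n) + b)"
      using u by (blast intro: relpow_trans_add)+
    then show ?thesis unfolding P_def by (intro exI[of _ "a + b"]) (simp add: ac_simps)
  qed
  have "P d"
  proof (cases "\<exists>g>0. P g")
    case True
    define g where "g = (LEAST g. 0 < g \<and> P g)"
    have g: "0 < g" "P g" and least: "\<And>a. 0 < a \<Longrightarrow> P a \<Longrightarrow> g \<le> a"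
      using True LeastI_ex[of "\<lambda>g. 0 < g \<and> P g"] unfolding g_def by (auto intro: Least_le)
    have dvd: "g dvd a" if "P a" for a
    proof -
      \<comment> \<open>Division with remainder: \<open>a mod g\<close> is a difference smaller than
        \<open>g\<close>, hence zero.\<close>
      have "P (a - (a div g) * g)" using that P_mult[OF g(2)] by (intro P_diff) auto
      then have "P (a mod g)" by (simp add: minus_div_mult_eq_mod)
      then show ?thesis using least[of "a mod g"] g(1)
        by (metis dvd_eq_mod_eq_0 leD mod_less_divisor neq0_conv)
    qed
    then have "g dvd Gcd {n. 0 < n \<and> (\<exists>u. (u, u) \<in> S ^^ n)}"
      using P_closed by (intro Gcd_greatest) auto
    then have "g dvd d" using d by (rule dvd_trans)
    then show ?thesis using P_mult[OF g(2)] by (metis dvd_div_mult_self)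
  next
    case False
    \<comment> \<open>Without closed walks of positive length the Gcd is 0, so
      \<open>d = 0\<close>.\<close>
    then have "{n. 0 < n \<and> (\<exists>u. (u, u) \<in> S ^^ n)} = {}" using P_closed by blast
    then show ?thesis using d P0 by (simp only: Gcd_empty dvd_0_left_iff)
  qed
  then show ?thesis unfolding P_def .
qed

text \<open>
  \<open>R\<close> is the arc relation of a multipartite tournament, \<open>C\<close> the vertex set of its last nontrivial
  strong component, and \<open>B\<close> and \<open>T\<close> are the vertices in components before and after it. The partite
  sets are the fibres of \<open>part\<close>.
\<close>

locale tournament_with_core =
  fixes R :: "'a rel" and B C T :: "'a set" and part :: "'a \<Rightarrow> nat"
  assumes field: "R \<subseteq> (B \<union> C \<union> T) \<times> (B \<union> C \<union> T)"
    and disjoint: "B \<inter> C = {}" "B \<inter> T = {}" "C \<inter> T = {}"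
    and adjacent: "\<And>x y. x \<in> B \<union> C \<union> T \<Longrightarrow> y \<in> B \<union> C \<union> T \<Longrightarrow>
          part x \<noteq> part y \<longleftrightarrow> (x, y) \<in> R \<or> (y, x) \<in> R"
    and arc_core: "\<And>x y. (x, y) \<in> R \<Longrightarrow> x \<in> C \<Longrightarrow> y \<in> C \<union> T"
    and arc_tail: "\<And>x y. (x, y) \<in> R \<Longrightarrow> x \<in> T \<Longrightarrow> y \<in> T"
    and tail_bounded: "\<exists>N. \<forall>x y m. x \<in> T \<longrightarrow> (x, y) \<in> R ^^ m \<longrightarrow> m \<le> N"
    and strong: "\<And>x y. x \<in> C \<Longrightarrow> y \<in> C \<Longrightarrow> (x, y) \<in> (R \<inter> C \<times> C)\<^sup>*"
    and nontrivial: "\<exists>x\<in>C. \<exists>y\<in>C. x \<noteq> y"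
begin

section \<open>Arcs and walks around the core\<close>

lemma arc_part: "(x, y) \<in> R \<Longrightarrow> part x \<noteq> part y"
  using adjacent field by blast

lemma core_successor:
  assumes "x \<in> C"
  obtains y where "y \<in> C" "(x, y) \<in> R"
proof -
  obtain y where "y \<in> C" "y \<noteq> x" using nontrivial by metis
  then show ?thesis using strong[OF assms, of y] that
    by (metis (no_types, lifting) IntD1 IntD2 SigmaD2 converse_rtranclE)
qed

text \<open>Vertices of different partite sets are adjacent, and the direction is forced because no
  arc leads from the core back to \<open>B\<close>.\<close>

lemma upper_arc: "x \<in> B \<Longrightarrow> y \<in> C \<Longrightarrow> part x \<noteq> part y \<Longrightarrow> (x, y) \<in> R"
  using adjacent arc_core disjoint by blast

lemma core_tail_arc: "x \<in> C \<Longrightarrow> w \<in> T \<Longrightarrow> part x \<noteq> part w \<Longrightarrow> (x, w) \<in> R"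
  using adjacent arc_tail disjoint by blast

lemma successor_in_core:
  assumes "x \<in> B \<union> C"
  obtains y where "y \<in> C" "(x, y) \<in> R"
proof (cases "x \<in> C")
  case True
  then show ?thesis using core_successor that by blast
next
  case False
  then have x: "x \<in> B" using assms by simp
  \<comment> \<open>A core arc joins two partite sets, so one of its ends avoids the set of
    \<open>x\<close>.\<close>
  obtain a b where "a \<in> C" "b \<in> C" "(a, b) \<in> R"
    using nontrivial core_successor by metis
  then show ?thesis using upper_arc[OF x] arc_part that by metis
qed

lemma walk_to_core:
  assumes "x \<in> B \<union> C" "0 < m"
  obtains y where "y \<in> C" "(x, y) \<in> R ^^ m"
proof -
  have "\<exists>y\<in>C. (x, y) \<in> R ^^ Suc n" for n
  proof (induction n)
    case 0
    then show ?case using successor_in_core[OF assms(1)] by auto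
  next
    case (Suc n)
    then show ?case using core_successor by (metis relpow_Suc_I)
  qed
  then show ?thesis using assms(2) that by (metis Suc_pred)
qed

lemma core_walk:
  assumes "x \<in> C"
  obtains y where "y \<in> C" "(x, y) \<in> R ^^ m"
  using assms walk_to_core[of x m] by (cases "m = 0") auto

lemma walk_from_core: "(x, y) \<in> R ^^ m \<Longrightarrow> x \<in> C \<Longrightarrow> y \<in> C \<union> T"
  by (induction m arbitrary: y) (auto dest: arc_core arc_tail)

section \<open>Persistence of common prey\<close>

lemma share_prey_persists:
  assumes "(u, w) \<in> R ^^ m" "(v, w) \<in> R ^^ m" "w \<in> B \<union> C"
  shows "\<forall>\<^sub>\<infinity>n. share_prey R n u v"
  unfolding MOST_nat
proof (intro exI allI impI)
  fix n assume "m < n"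
  then obtain y where "(w, y) \<in> R ^^ (n - m)" using walk_to_core[OF assms(3), of "n - m"] by auto
  then have "(u, y) \<in> R ^^ (m + (n - m))" "(v, y) \<in> R ^^ (m + (n - m))"
    using assms by (blast intro: relpow_trans_add)+
  then show "share_prey R n u v" using \<open>m < n\<close> by (auto intro: share_preyI)
qed

lemma MOST_share_prey_arcs:
  assumes "(u, x) \<in> R" "(v, y) \<in> R" "\<forall>\<^sub>\<infinity>n. share_prey R n x y"
  shows "\<forall>\<^sub>\<infinity>n. share_prey R n u v"
proof -
  have "share_prey R (Suc n) u v" if "share_prey R n x y" for n
    using that assms(1,2) relpow_Suc_I2 unfolding share_prey_def by metis
  then have "\<forall>\<^sub>\<infinity>n. share_prey R (Suc n) u v" using assms(3) by (rule MOST_mono[rotated])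
  then show ?thesis by (rule MOST_SucD)
qed

lemma tail_not_oscillates:
  assumes "u \<in> T"
  shows "\<not> oscillates (\<lambda>n. share_prey R n u v)"
proof -
  obtain N where "\<forall>x y m. x \<in> T \<longrightarrow> (x, y) \<in> R ^^ m \<longrightarrow> m \<le> N" using tail_bounded by blast
  then have "\<forall>n>N. \<not> share_prey R n u v" using assms by (auto simp: share_prey_def dest: leD)
  then show ?thesis by (auto simp: oscillates_def INFM_nat)
qed

lemma not_oscillates_if_upper:
  assumes "\<And>u v. u \<in> B \<union> C \<Longrightarrow> v \<in> B \<union> C \<Longrightarrow> \<not> oscillates (\<lambda>n. share_prey R n u v)"
    and "u \<in> B \<union> C \<union> T" "v \<in> B \<union> C \<union> T"
  shows "\<not> oscillates (\<lambda>n. share_prey R n u v)"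
  using assms tail_not_oscillates[of u v] tail_not_oscillates[of v u]
  by (auto simp: share_prey_commute[of R _ v u])

lemma not_oscillates_if_core_shares:
  assumes "\<And>x y. x \<in> C \<Longrightarrow> y \<in> C \<Longrightarrow> \<forall>\<^sub>\<infinity>n. share_prey R n x y"
    and "u \<in> B \<union> C \<union> T" "v \<in> B \<union> C \<union> T"
  shows "\<not> oscillates (\<lambda>n. share_prey R n u v)"
proof (rule not_oscillates_if_upper[OF _ assms(2,3)])
  fix u v assume "u \<in> B \<union> C" "v \<in> B \<union> C"
  then obtain x y where "x \<in> C" "y \<in> C" "(u, x) \<in> R" "(v, y) \<in> R"
    using successor_in_core by metis
  then show "\<not> oscillates (\<lambda>n. share_prey R n u v)"
    using assms(1) MOST_share_prey_arcs not_oscillates_if_MOST by blast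
qed

text \<open>A prey in the tail cannot be prolonged forever, so a fresh one is chosen for every
  length: both vertices walk \<open>n\<close> steps to core vertices and then enter a common
  \<open>w\<close>.\<close>

lemma MOST_share_prey_if_common_tail:
  assumes "x \<in> C" "y \<in> C"
    and "\<And>n x' y'. x' \<in> C \<Longrightarrow> y' \<in> C \<Longrightarrow> (x, x') \<in> R ^^ n \<Longrightarrow> (y, y') \<in> R ^^ n \<Longrightarrow>
      \<exists>w\<in>T. part w \<noteq> part x' \<and> part w \<noteq> part y'"
  shows "\<forall>\<^sub>\<infinity>n. share_prey R n x y"
proof -
  have "share_prey R (Suc n) x y" for n
  proof -
    obtain x' y' where "x' \<in> C" "(x, x') \<in> R ^^ n" "y' \<in> C" "(y, y') \<in> R ^^ n"
      using core_walk assms(1,2) by metis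
    then show ?thesis
      using assms(3)[of x' y' n] core_tail_arc share_preyI[OF relpow_Suc_I relpow_Suc_I] by metis
  qed
  then have "\<forall>\<^sub>\<infinity>n. share_prey R (Suc n) x y" by (simp add: MOST_I)
  then show ?thesis by (rule MOST_SucD)
qed

section \<open>Cores contained in two partite sets\<close>

text \<open>Every arc between sets 1 and 2 switches sides, which fixes the parity. The first
  alternative records that a vertex outside both sets can be reached from \<open>u\<close>.\<close>

lemma walk_parity:
  assumes "(u, w) \<in> R ^^ m" "u \<in> B \<union> C \<union> T"
  shows "(\<exists>i z. (u, z) \<in> R ^^ i \<and> z \<in> B \<union> C \<union> T \<and> part z \<notin> {1, 2}) \<or>
    part w \<in> {1, 2} \<and> part u \<in> {1, 2} \<and> (part w = part u \<longleftrightarrow> even m)"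
  using assms(1)
proof (induction m arbitrary: w)
  case 0
  then show ?case using assms(2) by (metis even_zero relpow_0_E relpow_0_I)
next
  case (Suc m)
  then obtain z where z: "(u, z) \<in> R ^^ m" "(z, w) \<in> R" by auto
  have w: "w \<in> B \<union> C \<union> T" using field z by blast
  show ?case
  proof (cases "part w \<in> {1, 2}")
    case True
    then show ?thesis using Suc.IH[OF z(1)] arc_part[OF z(2)] by auto
  next
    case False
    then show ?thesis using Suc.prems w by blast
  qed
qed

text \<open>
  Within partite sets 1 and 2 every walk alternates, so vertices from different sets never meet there.
  A walk leaving these two sets does so at a vertex of \<open>B\<close>, which dominates the whole core.
\<close>

lemma bipartite_core_not_oscillates:
  assumes core: "part ` C \<subseteq> {1, 2}"
    and same: "\<And>x y. x \<in> C \<Longrightarrow> y \<in> C \<Longrightarrow> part x = part y \<Longrightarrow> \<forall>\<^sub>\<infinity>n. share_prey R n x y"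
    and uv: "u \<in> B \<union> C \<union> T" "v \<in> B \<union> C \<union> T"
  shows "\<not> oscillates (\<lambda>n. share_prey R n u v)"
proof (cases "part ` T \<subseteq> {1, 2}")
  case False
  then obtain w where w: "w \<in> T" "part w \<notin> {1, 2}" by blast
  \<comment> \<open>Every core vertex dominates such a \<open>w\<close>, so two core walks of equal
    length can always end in it.\<close>
  have "\<forall>\<^sub>\<infinity>n. share_prey R n x y" if "x \<in> C" "y \<in> C" for x y
    using MOST_share_prey_if_common_tail[OF that] w core by fastforce
  then show ?thesis using not_oscillates_if_core_shares uv by blast
next
  case tail: True
  show ?thesis
  proof (rule not_oscillates_if_upper[OF _ uv])
    fix u v assume u: "u \<in> B \<union> C" and v: "v \<in> B \<union> C"
    \<comment> \<open>Only \<open>B\<close> can contain \<open>z\<close>. Meanwhile \<open>v\<close>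
      can reach some core vertex \<open>y\<close> in \<open>i + 1\<close> steps; \<open>z\<close>
      dominates it, so \<open>y\<close> is a common prey in the core.\<close>
    have escape: "\<forall>\<^sub>\<infinity>n. share_prey R n u v"
      if u: "u \<in> B \<union> C" and v: "v \<in> B \<union> C"
        and z: "(u, z) \<in> R ^^ i" "z \<in> B \<union> C \<union> T" "part z \<notin> {1, 2}" for u v z i
    proof -
      have zB: "z \<in> B" using z core tail by blast
      obtain y where y: "y \<in> C" "(v, y) \<in> R ^^ Suc i" using walk_to_core[OF v, of "Suc i"] by auto
      then have "part z \<noteq> part y" using core z(3) by force
      then have "(z, y) \<in> R" using zB y(1) upper_arc by blast
      then have "(u, y) \<in> R ^^ Suc i" using z(1) by (rule relpow_Suc_I[rotated])
      then show ?thesis using y share_prey_persists by blast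
    qed
    show "\<not> oscillates (\<lambda>n. share_prey R n u v)"
    proof (rule not_oscillatesI)
      fix m assume "share_prey R m u v"
      then obtain w where w: "(u, w) \<in> R ^^ m" "(v, w) \<in> R ^^ m" by (auto simp: share_prey_def)
      have *: "u \<in> B \<union> C \<union> T" "v \<in> B \<union> C \<union> T" using u v by auto
      \<comment> \<open>Both walks have the same length and the same end, so they start on the same
        side.\<close>
      have "part u = part v" if "part w \<in> {1, 2}" "part u \<in> {1, 2}" "part v \<in> {1, 2}"
        "part w = part u \<longleftrightarrow> even m" "part w = part v \<longleftrightarrow> even m"
        using that by auto
      then consider (u) "\<exists>i z. (u, z) \<in> R ^^ i \<and> z \<in> B \<union> C \<union> T \<and> part z \<notin> {1, 2}"
        | (v) "\<exists>i z. (v, z) \<in> R ^^ i \<and> z \<in> B \<union> C \<union> T \<and> part z \<notin> {1, 2}"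
        | (same) "part u \<in> {1, 2}" "part u = part v"
        using walk_parity[OF w(1) *(1)] walk_parity[OF w(2) *(2)] by argo
      then show "\<forall>\<^sub>\<infinity>n. share_prey R n u v"
      proof cases
        case u': u
        then show ?thesis using escape[OF u v] by blast
      next
        case v': v
        then show ?thesis using escape[OF v u] unfolding share_prey_commute[of R _ v u] by blast
      next
        case s: same
        obtain x y where xy: "x \<in> C" "y \<in> C" "(u, x) \<in> R" "(v, y) \<in> R"
          using u v successor_in_core by metis
        have "part x \<in> {1, 2}" "part y \<in> {1, 2}" using core xy by auto
        \<comment> \<open>With only two sets, both successors lie in the one opposite to
          \<open>u\<close> and \<open>v\<close>.\<close>
        then have "part x = part y" using s arc_part[OF xy(3)] arc_part[OF xy(4)] by auto
        then show ?thesis using MOST_share_prey_arcs[OF xy(3,4)] same xy by blast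
      qed
    qed
  qed
qed

section \<open>Cores of index one and two\<close>

text \<open>There are closed walks at \<open>x\<close> of lengths \<open>n + d\<close> and
  \<open>n\<close>. While \<open>x\<close> takes the longer one, \<open>y\<close> walks to
  \<open>x\<close> in \<open>d\<close> steps and then takes the shorter one; both end at
  \<open>x\<close>, a prey in the core.\<close>

lemma same_class_shares:
  assumes xy: "x \<in> C" "y \<in> C"
    and walk: "(y, x) \<in> (R \<inter> C \<times> C) ^^ d"
    and d: "Gcd {n. 0 < n \<and> (\<exists>u. (u, u) \<in> (R \<inter> C \<times> C) ^^ n)} dvd d"
  shows "\<forall>\<^sub>\<infinity>n. share_prey R n x y"
proof -
  obtain n where n: "(x, x) \<in> (R \<inter> C \<times> C) ^^ (n + d)" "(x, x) \<in> (R \<inter> C \<times> C) ^^ n"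
    using Gcd_dvd_imp_closed_walk_difference[of C "R \<inter> C \<times> C" x d] strong xy d by auto
  have "(y, x) \<in> (R \<inter> C \<times> C) ^^ (n + d)"
    using relpow_trans_add[OF walk n(2)] by (simp add: add.commute)
  moreover have "(R \<inter> C \<times> C) ^^ (n + d) \<subseteq> R ^^ (n + d)"
    by (intro relpow_subset) auto
  ultimately show ?thesis using n(1) share_prey_persists xy by blast
qed

lemma primitive_not_oscillates:
  assumes "Gcd {n. 0 < n \<and> (\<exists>u. (u, u) \<in> (R \<inter> C \<times> C) ^^ n)} = 1"
    and "u \<in> B \<union> C \<union> T" "v \<in> B \<union> C \<union> T"
  shows "\<not> oscillates (\<lambda>n. share_prey R n u v)"
proof (rule not_oscillates_if_core_shares[OF _ assms(2,3)])
  fix x y assume xy: "x \<in> C" "y \<in> C"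
  then obtain d where "(y, x) \<in> (R \<inter> C \<times> C) ^^ d" using strong by (meson rtrancl_imp_relpow)
  then show "\<forall>\<^sub>\<infinity>n. share_prey R n x y" using same_class_shares[OF xy] assms(1) by simp
qed

lemma core_walk_parity:
  assumes "(x, y) \<in> R ^^ n" "x \<in> C" "y \<in> C" and core: "part ` C \<subseteq> {1, 2}"
  shows "part y = part x \<longleftrightarrow> even n"
  using assms(1-3)
proof (induction n arbitrary: y)
  case 0
  then show ?case by simp
next
  case (Suc n)
  then obtain z where z: "(x, z) \<in> R ^^ n" "(z, y) \<in> R" by auto
  then have "z \<in> C" using Suc.prems walk_from_core arc_tail disjoint by blast
  moreover have "part x \<in> {1, 2}" "part y \<in> {1, 2}" "part z \<in> {1, 2}"
    using core Suc.prems \<open>z \<in> C\<close> by blast+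
  ultimately show ?case using Suc.IH[OF z(1)] Suc.prems arc_part[OF z(2)] by auto
qed

text \<open>A walk between core vertices of one partite set has even length, which the index 2
  divides, so \<open>same_class_shares\<close> applies.\<close>

lemma index_two_not_oscillates:
  assumes "Gcd {n. 0 < n \<and> (\<exists>u. (u, u) \<in> (R \<inter> C \<times> C) ^^ n)} = 2"
    and core: "part ` C \<subseteq> {1, 2}"
    and "u \<in> B \<union> C \<union> T" "v \<in> B \<union> C \<union> T"
  shows "\<not> oscillates (\<lambda>n. share_prey R n u v)"
proof (rule bipartite_core_not_oscillates[OF core _ assms(3,4)])
  fix x y assume xy: "x \<in> C" "y \<in> C" "part x = part y"
  then obtain d where d: "(y, x) \<in> (R \<inter> C \<times> C) ^^ d" using strong by (meson rtrancl_imp_relpow)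
  then have "(y, x) \<in> R ^^ d" using relpow_subset[of "R \<inter> C \<times> C" R d] by blast
  then have "even d" using core_walk_parity core xy by metis
  then show "\<forall>\<^sub>\<infinity>n. share_prey R n x y" using same_class_shares[OF xy(1,2) d] assms(1) by simp
qed

section \<open>Cores of index four\<close>

text \<open>Two core vertices of one partite set may belong to opposite classes and never meet in
  the core, but they alternate between sets 1 and 2 in step. As the tail is not contained in the set
  currently occupied, it has a vertex that both dominate.\<close>

lemma index_four_not_oscillates:
  assumes core: "part ` C \<subseteq> {1, 2}"
    and tail: "\<And>j. j \<in> {1, 2} \<Longrightarrow> \<not> part ` T \<subseteq> {j}"
    and "u \<in> B \<union> C \<union> T" "v \<in> B \<union> C \<union> T"
  shows "\<not> oscillates (\<lambda>n. share_prey R n u v)"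
proof (rule bipartite_core_not_oscillates[OF core _ assms(3,4)])
  fix x y assume xy: "x \<in> C" "y \<in> C" "part x = part y"
  show "\<forall>\<^sub>\<infinity>n. share_prey R n x y"
  proof (rule MOST_share_prey_if_common_tail[OF xy(1,2)])
    fix n x' y' assume w: "x' \<in> C" "y' \<in> C" "(x, x') \<in> R ^^ n" "(y, y') \<in> R ^^ n"
    have "part ` {x, x', y'} \<subseteq> {1, 2}" using core w xy by blast
    moreover have "part x' = part x \<longleftrightarrow> part y' = part x"
      using core_walk_parity[OF w(3)] core_walk_parity[OF w(4)] w xy core by metis
    ultimately have "part x' \<in> {1, 2}" "part x' = part y'" by auto
    then show "\<exists>w\<in>T. part w \<noteq> part x' \<and> part w \<noteq> part y'" using tail[of "part x'"] by auto
  qed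
qed

lemma pos_walk:
  fixes pos :: "'a \<Rightarrow> nat"
  assumes pos_arc: "\<And>x y. x \<in> C \<Longrightarrow> y \<in> C \<Longrightarrow> (x, y) \<in> R \<Longrightarrow> pos y mod \<kappa> = (pos x + 1) mod \<kappa>"
    and "(x, y) \<in> R ^^ m" "x \<in> C" "y \<in> C"
  shows "pos y mod \<kappa> = (pos x + m) mod \<kappa>"
  using assms(2-4)
proof (induction m arbitrary: y)
  case 0
  then show ?case by simp
next
  case (Suc m)
  then obtain z where z: "(x, z) \<in> R ^^ m" "(z, y) \<in> R" by auto
  then have "z \<in> C" using Suc.prems walk_from_core arc_tail disjoint by blast
  then have "pos y mod \<kappa> = (pos z mod \<kappa> + 1) mod \<kappa>" using pos_arc Suc.prems z by (simp add: mod_simps)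
  also have "\<dots> = ((pos x + m) mod \<kappa> + 1) mod \<kappa>" using Suc.IH[OF z(1)] Suc.prems \<open>z \<in> C\<close> by simp
  also have "\<dots> = (pos x + Suc m) mod \<kappa>" by (simp add: mod_simps)
  finally show ?case .
qed

text \<open>With \<open>y\<close> two steps after \<open>x\<close>, both lie in one partite set but
  in opposite classes, so all common preys are in the tail. The tail lies in the single set
  \<open>j\<close>, so it has no arcs and is entered only from the other set: sharing alternates
  with the parity of the length.\<close>

lemma index_four_oscillates:
  fixes pos :: "'a \<Rightarrow> nat"
  assumes pos_arc: "\<And>x y. x \<in> C \<Longrightarrow> y \<in> C \<Longrightarrow> (x, y) \<in> R \<Longrightarrow> pos y mod 4 = (pos x + 1) mod 4"
    and pos_part: "\<And>x. x \<in> C \<Longrightarrow> part x = (if odd (pos x) then 1 else 2)"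
    and tail: "T \<noteq> {}" "part ` T \<subseteq> {j}" "j \<in> {1, 2}"
  shows "\<exists>x\<in>C. \<exists>y\<in>C. x \<noteq> y \<and> oscillates (\<lambda>n. share_prey R n x y)"
proof -
  have pos_walk: "pos y mod 4 = (pos x + m) mod 4" if "(x, y) \<in> R ^^ m" "x \<in> C" "y \<in> C" for x y m
    using pos_walk[of pos 4, OF pos_arc that] .
  obtain x where x: "x \<in> C" using nontrivial by blast
  obtain y where y: "y \<in> C" "(x, y) \<in> R ^^ 2" using core_walk[OF x] by metis
  have pos_y: "pos y mod 4 = (pos x + 2) mod 4" using pos_walk[OF y(2) x y(1)] .
  obtain w where w: "w \<in> T" "part w = j" using tail by blast
  have "oscillates (\<lambda>n. share_prey R n x y)"
  \<comment> \<open>Phase \<open>j + 1\<close> lies in the set opposite to \<open>j\<close>: the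
    next step can enter the tail, while a walk that is in the tail now would have come from phase
    \<open>j\<close>, inside set \<open>j\<close>.\<close>
  proof (rule oscillates_if_residues[where k=4 and p="pos x" and a="j + 1" and b="j + 1"])
    fix n assume n: "(pos x + n) mod 4 = (j + 1) mod 4"
    obtain x' y' where w': "x' \<in> C" "(x, x') \<in> R ^^ n" "y' \<in> C" "(y, y') \<in> R ^^ n"
      using core_walk x y(1) by metis
    have "pos x' mod 4 = (pos x + n) mod 4" "pos y' mod 4 = (pos y + n) mod 4"
      using pos_walk w' x y(1) by blast+
    then have "pos x' mod 4 = (j + 1) mod 4" "pos y' mod 4 = (j + 1 + 2) mod 4"
      using n mod_shift[OF pos_y n] by (simp_all only:)
    then have "odd (pos x') \<longleftrightarrow> j = 2" "odd (pos y') \<longleftrightarrow> j = 2"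
      using tail(3) odd_mod_4_iff[of "pos x'"] odd_mod_4_iff[of "pos y'"] by auto
    then have "(x', w) \<in> R" "(y', w) \<in> R"
      using core_tail_arc w w' pos_part tail(3) by auto
    then show "share_prey R (Suc n) x y" using w' by (blast intro: share_preyI relpow_Suc_I)
  next
    fix n assume n: "(pos x + n) mod 4 = (j + 1) mod 4"
    show "\<not> share_prey R n x y"
    proof
      assume "share_prey R n x y"
      then obtain v where v: "(x, v) \<in> R ^^ n" "(y, v) \<in> R ^^ n" by (auto simp: share_prey_def)
      show False
      proof (cases "v \<in> C")
        case True
        then have "(pos x + n) mod 4 = (pos y + n) mod 4"
          using pos_walk v x y(1) by metis
        then have "(j + 1) mod 4 = (j + 1 + 2) mod 4" using n mod_shift[OF pos_y n] by simp
        then show False using tail(3) by auto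
      next
        case False
        then have vT: "v \<in> T" using walk_from_core[OF v(1) x] by blast
        then obtain m z where z: "n = Suc m" "(x, z) \<in> R ^^ m" "(z, v) \<in> R"
          using v(1) x False by (cases n) auto
        \<comment> \<open>No arc joins two vertices of \<open>T\<close>, so the last step starts in
          the core.\<close>
        have "z \<in> C"
          using walk_from_core[OF z(2) x] arc_part[OF z(3)] vT tail(2) by auto
        then have "pos z mod 4 = (pos x + m) mod 4" using pos_walk z x by blast
        then have "(pos z + 1) mod 4 = (j + 1) mod 4" using n z(1) by (metis add.assoc mod_add_left_eq Suc_eq_plus1)
        then have "odd (pos z) \<longleftrightarrow> j = 1" using tail(3) odd_mod_4_iff[of "pos z + 1"] by auto
        moreover have "part v = j" using vT tail(2) by auto
        ultimately show False using pos_part \<open>z \<in> C\<close> arc_part[OF z(3)] tail(3) by auto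
      qed
    qed
  qed simp
  moreover have "pos x mod 4 \<noteq> (pos x + 2) mod 4" by presburger
  then have "x \<noteq> y" using pos_y by metis
  ultimately show ?thesis using x y(1) by blast
qed

section \<open>Cores of index three\<close>

context
  assumes core3: "part ` C \<subseteq> {1, 2, 3}"
    and rotate: "\<And>x y. x \<in> C \<Longrightarrow> y \<in> C \<Longrightarrow> (x, y) \<in> R \<Longrightarrow> part y = part x mod 3 + 1"
begin

lemma core_part: "x \<in> C \<Longrightarrow> part x \<in> {1, 2, 3}"
  using core3 by blast

lemma residue_cancel:
  assumes "a \<in> {1, 2, 3 :: nat}" "b \<in> {1, 2, 3}" "(a + n) mod 3 = (b + n) mod 3"
  shows "a = b"
proof -
  have "int ((a + n) mod 3) = int ((b + n) mod 3)" using assms(3) by simp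
  then have "(int a + int n) mod 3 = (int b + int n) mod 3" by (simp add: zmod_int)
  then have "int a mod 3 = int b mod 3" by (metis add_diff_cancel_right' mod_diff_left_eq)
  then show ?thesis using assms(1,2) by auto
qed

lemma part_walk: "(x, y) \<in> R ^^ m \<Longrightarrow> x \<in> C \<Longrightarrow> y \<in> C \<Longrightarrow> part y mod 3 = (part x + m) mod 3"
  by (rule pos_walk) (simp_all add: rotate mod_simps)

text \<open>The hypothesis denies the divergence condition: whenever two consecutive sets hold the
  tail, some tail arc runs back from the second to the first. Core walks from different classes
  occupy two sets at each time; either both dominate a tail vertex outside these sets, or the tail
  lies in them and the back arc supplies a common prey.\<close>

lemma index_three_not_oscillates:
  assumes tail: "\<And>j. j \<in> {1, 2, 3} \<Longrightarrow> part ` T \<subseteq> {j, j mod 3 + 1} \<Longrightarrow>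
      \<exists>p\<in>T. \<exists>q\<in>T. part p = j mod 3 + 1 \<and> part q = j \<and> (p, q) \<in> R"
    and uv: "u \<in> B \<union> C \<union> T" "v \<in> B \<union> C \<union> T"
  shows "\<not> oscillates (\<lambda>n. share_prey R n u v)"
proof (rule not_oscillates_if_core_shares[OF _ uv])
  fix x y assume xy: "x \<in> C" "y \<in> C"
  show "\<forall>\<^sub>\<infinity>n. share_prey R n x y"
  proof (cases "part x = part y")
    case True
    \<comment> \<open>Any successor \<open>z\<close> of \<open>x\<close> in the core serves:
      \<open>y\<close> is adjacent to it, and an arc from \<open>z\<close> to \<open>y\<close> would
      violate the rotation.\<close>
    obtain z where z: "z \<in> C" "(x, z) \<in> R" using core_successor xy(1) by blast
    have "part z = part y mod 3 + 1" using rotate[OF xy(1) z] True by simp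
    then have "(z, y) \<notin> R" "part y \<noteq> part z"
      using rotate[of z y] z xy core_part[OF xy(2)] by auto
    then have "(y, z) \<in> R" using adjacent xy z by blast
    then have "(x, z) \<in> R ^^ 1" "(y, z) \<in> R ^^ 1" using z by simp_all
    then show ?thesis using share_prey_persists z(1) by blast
  next
    case False
    have "share_prey R (Suc (Suc n)) x y" for n
    proof -
      obtain x1 y1 where 1: "x1 \<in> C" "(x, x1) \<in> R ^^ n" "y1 \<in> C" "(y, y1) \<in> R ^^ n"
        using core_walk xy by metis
      obtain x2 y2 where 2: "x2 \<in> C" "(x1, x2) \<in> R" "y2 \<in> C" "(y1, y2) \<in> R"
        using core_successor 1 by metis
      have neq: "part x1 \<noteq> part y1"
        using part_walk[OF 1(2) xy(1) 1(1)] part_walk[OF 1(4) xy(2) 1(3)] False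
          residue_cancel[OF core_part[OF xy(1)] core_part[OF xy(2)], of n] by metis
      have rot: "part x2 = part x1 mod 3 + 1" "part y2 = part y1 mod 3 + 1"
        using rotate 1 2 by blast+
      show ?thesis
      proof (cases "part ` T \<subseteq> {part x2, part y2}")
        case False
        then obtain w where "w \<in> T" "part w \<noteq> part x2" "part w \<noteq> part y2" by blast
        then have "(x2, w) \<in> R" "(y2, w) \<in> R" using core_tail_arc 2 by metis+
        then show ?thesis using 1 2 by (blast intro: share_preyI relpow_Suc_I)
      next
        case True
        \<comment> \<open>Two of three sets are cyclically consecutive in one order,
          \<open>j\<close> being the first. One step earlier both walks avoid the set
          \<open>j mod 3 + 1\<close>, so both can enter the tail at \<open>p\<close> and continue to
          \<open>q\<close>.\<close>
        obtain j where j: "j \<in> {1, 2, 3}" "{part x2, part y2} = {j, j mod 3 + 1}"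
          and new: "j mod 3 + 1 \<noteq> part x1" "j mod 3 + 1 \<noteq> part y1"
        proof (cases "part y2 = part x2 mod 3 + 1")
          case True
          then show ?thesis using that[of "part x2"] neq rot core_part[OF 1(1)] core_part[OF 1(3)]
            by auto
        next
          case False
          then have x2: "part x2 = part y2 mod 3 + 1" and "part y2 \<in> {1, 2, 3}"
            "part y2 mod 3 + 1 \<noteq> part x1" "part y2 mod 3 + 1 \<noteq> part y1"
            using neq rot core_part[OF 1(1)] core_part[OF 1(3)] by auto
          moreover have "{part x2, part y2} = {part y2, part y2 mod 3 + 1}"
            unfolding x2 by (rule insert_commute)
          ultimately show ?thesis using that by blast
        qed
        obtain p q where pq: "p \<in> T" "q \<in> T" "part p = j mod 3 + 1" "(p, q) \<in> R"
          using tail[OF j(1)] True j(2) by auto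
        then have "(x1, p) \<in> R" "(y1, p) \<in> R" using core_tail_arc 1 new by metis+
        then show ?thesis using 1 pq(4) by (blast intro: share_preyI relpow_Suc_I)
      qed
    qed
    then have "\<forall>\<^sub>\<infinity>n. share_prey R (Suc (Suc n)) x y" by (simp add: MOST_I)
    then have "\<forall>\<^sub>\<infinity>n. share_prey R (Suc n) x y"
      by (rule MOST_SucD[where P="\<lambda>n. share_prey R (Suc n) x y"])
    then show ?thesis by (rule MOST_SucD)
  qed
qed

text \<open>With \<open>y\<close> one step after \<open>x\<close>, the classes always differ and no
  common prey lies in the core. Tail arcs lead only from set \<open>j\<close> to set
  \<open>j mod 3 + 1\<close>, so a walk has at most one arc inside the tail, and its phase restricts
  the set in which it can end.\<close>

lemma index_three_oscillates:
  assumes tail: "T \<noteq> {}" "j \<in> {1, 2, 3}" "part ` T \<subseteq> {j, j mod 3 + 1}"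
    and forward: "\<And>p q. p \<in> T \<Longrightarrow> q \<in> T \<Longrightarrow> part p = j mod 3 + 1 \<Longrightarrow> part q = j \<Longrightarrow> (p, q) \<notin> R"
  shows "\<exists>x\<in>C. \<exists>y\<in>C. x \<noteq> y \<and> oscillates (\<lambda>n. share_prey R n x y)"
proof -
  obtain x where x: "x \<in> C" using nontrivial by blast
  obtain y where y: "y \<in> C" "(x, y) \<in> R" using core_successor[OF x] by metis
  have part_y: "part y = part x mod 3 + 1" using rotate x y by blast
  have part_y_mod: "part y mod 3 = (part x + 1) mod 3" by (simp add: part_y mod_simps)
  obtain w where w: "w \<in> T" using tail by blast
  have part_w: "part w \<in> {1, 2, 3}" using tail w by auto
  \<comment> \<open>In the phase where the core walks are in class \<open>j + 1\<close>, only tail vertices of class \<open>j + 1\<close> are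
    reached; when they are in class \<open>j + 2\<close>, only those of class \<open>j\<close>; class \<open>j\<close> gives no restriction.\<close>
  have invariant: "w \<in> C \<or> (part x + m) mod 3 = j mod 3 \<or>
      (part x + m) mod 3 = (j + 1) mod 3 \<and> part w = j mod 3 + 1 \<or>
      (part x + m) mod 3 = (j + 2) mod 3 \<and> part w = j" 
    if "(x, w) \<in> R ^^ m" "x \<in> C" for x w m
    using that
  proof (induction m arbitrary: w)
    case 0
    then show ?case by simp
  next
    case (Suc m)
    then obtain z where z: "(x, z) \<in> R ^^ m" "(z, w) \<in> R" by auto
    have Suc_mod: "(part x + Suc m) mod 3 = Suc ((part x + m) mod 3) mod 3"
      by (simp add: mod_Suc_eq)
    show ?case
    proof (cases "w \<in> C")
      case False
      then have wT: "w \<in> T" using walk_from_core Suc.prems by blast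
      then have w: "part w = j \<or> part w = j mod 3 + 1" using tail by blast
      show ?thesis
      proof (cases "z \<in> C")
        case True
        then have "part z mod 3 = (part x + m) mod 3" using part_walk z Suc.prems by blast
        then show ?thesis using w arc_part[OF z(2)] core_part[OF True] tail(2)
          unfolding Suc_mod by auto
      next
        case False
        then have zT: "z \<in> T" using walk_from_core z Suc.prems by blast
        then have "part z = j" "part w = j mod 3 + 1"
          using tail(3) forward[OF zT wT] w arc_part[OF z(2)] z(2) by auto
        then show ?thesis using Suc.IH[OF z(1) Suc.prems(2)] False tail(2)
          unfolding Suc_mod by auto
      qed
    qed simp
  qed
  have "oscillates (\<lambda>n. share_prey R n x y)"
  \<comment> \<open>At phase \<open>part w + 1\<close> of \<open>x\<close> both walks are outside
    the set of \<open>w\<close>, so both can reach \<open>w\<close> next. At phase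
    \<open>j + 1\<close> the phase of \<open>y\<close> is \<open>j + 2\<close>, and the invariant
    puts a common tail vertex into two different sets.\<close>
  proof (rule oscillates_if_residues[where k=3 and p="part x" and a="part w + 1" and b="j + 1"])
    fix n assume n: "(part x + n) mod 3 = (part w + 1) mod 3"
    obtain x' y' where w': "x' \<in> C" "(x, x') \<in> R ^^ n" "y' \<in> C" "(y, y') \<in> R ^^ n"
      using core_walk x y(1) by metis
    have "part x' mod 3 = (part x + n) mod 3" "part y' mod 3 = (part y + n) mod 3"
      using part_walk w' x y(1) by blast+
    then have "part x' mod 3 = (part w + 1) mod 3" "part y' mod 3 = (part w + 1 + 1) mod 3"
      using n mod_shift[OF part_y_mod n] by simp_all
    then have "part x' \<noteq> part w" "part y' \<noteq> part w"
      using part_w by auto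
    then have "(x', w) \<in> R" "(y', w) \<in> R"
      using core_tail_arc w w' by auto
    then show "share_prey R (Suc n) x y" using w' by (blast intro: share_preyI relpow_Suc_I)
  next
    fix n assume n: "(part x + n) mod 3 = (j + 1) mod 3"
    then have n': "(part y + n) mod 3 = (j + 2) mod 3" using mod_shift[OF part_y_mod n] by simp
    show "\<not> share_prey R n x y"
    proof
      assume "share_prey R n x y"
      then obtain v where v: "(x, v) \<in> R ^^ n" "(y, v) \<in> R ^^ n" by (auto simp: share_prey_def)
      show False
      proof (cases "v \<in> C")
        case True
        then have "(part x + n) mod 3 = (part y + n) mod 3"
          using part_walk v x y(1) by metis
        then have "(j + 1) mod 3 = (j + 2) mod 3" using n n' by simp
        then show False using tail(2) by auto
      next
        case False
        have "part v = j mod 3 + 1"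
          using invariant[OF v(1) x] False n tail(2) by auto
        moreover have "part v = j"
          using invariant[OF v(2) y(1)] False n' tail(2) by auto
        ultimately show False using tail(2) by auto
      qed
    qed
  qed simp
  moreover have "x \<noteq> y" using arc_part y(2) by blast
  ultimately show ?thesis using x y(1) by blast
qed

end

section \<open>Empty tail and bound on the index\<close>

lemma empty_tail_not_oscillates:
  assumes "T = {}" "u \<in> B \<union> C \<union> T" "v \<in> B \<union> C \<union> T"
  shows "\<not> oscillates (\<lambda>n. share_prey R n u v)"
proof (rule not_oscillatesI)
  fix m assume "share_prey R m u v"
  then obtain w where w: "(u, w) \<in> R ^^ m" "(v, w) \<in> R ^^ m" by (auto simp: share_prey_def)
  then have "w \<in> B \<union> C" using assms field by (cases m) auto
  then show "\<forall>\<^sub>\<infinity>n. share_prey R n u v" using w share_prey_persists by blast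
qed

text \<open>
  With at least five classes, classes 1 and 3 as well as 1 and 4 are nonadjacent, hence classes 3 and
  4 lie in the same partite set although there are arcs between them.
\<close>

lemma index_le_four:
  fixes pos :: "'a \<Rightarrow> nat"
  assumes onto: "\<And>i. i \<in> {1..\<kappa>} \<Longrightarrow> \<exists>x\<in>C. pos x = i"
    and arc: "\<And>x y. x \<in> C \<Longrightarrow> y \<in> C \<Longrightarrow> (x, y) \<in> R \<Longrightarrow> pos y = pos x mod \<kappa> + 1"
  shows "\<kappa> \<le> 4"
proof (rule ccontr)
  assume "\<not> \<kappa> \<le> 4"
  then have \<kappa>: "5 \<le> \<kappa>" by simp
  have "1 \<in> {1..\<kappa>}" "3 \<in> {1..\<kappa>}" using \<kappa> by auto
  then obtain x z where x: "x \<in> C" "pos x = 1" and z: "z \<in> C" "pos z = 3" using onto by metis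
  obtain y where y: "y \<in> C" "(z, y) \<in> R" using core_successor z(1) by blast
  have "pos y = 4" using arc[OF z(1) y] z(2) \<kappa> by simp
  then have "(x, y) \<notin> R" "(y, x) \<notin> R" "(x, z) \<notin> R" "(z, x) \<notin> R"
    using arc[of x y] arc[of y x] arc[of x z] arc[of z x] x y(1) z \<kappa> by auto
  then have "part x = part y" "part x = part z" using adjacent x y(1) z by blast+
  then show False using arc_part[OF y(2)] by simp
qed

end


section \<open>Walks, competition graphs and index in terms of the arc relation\<close>

lemma (in wf_digraph) ex_awalk_length_iff:
  "u \<in> verts G \<Longrightarrow> (\<exists>p. awalk u p w \<and> length p = m) \<longleftrightarrow> (u, w) \<in> arcs_ends G ^^ m"
proof (induction m arbitrary: u)
  case 0
  then show ?case by (auto simp: awalk_Nil_iff)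
next
  case (Suc m)
  have "(\<exists>p. awalk u p w \<and> length p = Suc m) \<longleftrightarrow> (\<exists>e p. awalk u (e # p) w \<and> length p = m)"
    by (auto simp: length_Suc_conv)
  also have "\<dots> \<longleftrightarrow>
      (\<exists>e\<in>arcs G. tail G e = u \<and> (\<exists>p. awalk (head G e) p w \<and> length p = m))"
    by (auto simp: awalk_Cons_iff)
  also have "\<dots> \<longleftrightarrow> (\<exists>e\<in>arcs G. tail G e = u \<and> (head G e, w) \<in> arcs_ends G ^^ m)"
    using Suc.IH by auto
  also have "\<dots> \<longleftrightarrow> (u, w) \<in> arcs_ends G O arcs_ends G ^^ m"
    by (auto simp: arcs_ends_conv)
  finally show ?case by (simp add: relpow_commute)
qed

lemma (in wf_digraph) arcs_ends_subset: "arcs_ends G \<subseteq> verts G \<times> verts G"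
  by (auto simp: arcs_ends_conv)

lemma (in wf_digraph) step_competition_graph_conv:
  "step_competition_graph m G = \<lparr> pverts = verts G,
     parcs = {(u, v). u \<in> verts G \<and> v \<in> verts G \<and> u \<noteq> v \<and> share_prey (arcs_ends G) m u v} \<rparr>"
proof -
  have "u \<in> verts G \<and> v \<in> verts G \<and> u \<noteq> v \<and>
        (\<exists>w p q. awalk u p w \<and> length p = m \<and> awalk v q w \<and> length q = m) \<longleftrightarrow>
      u \<in> verts G \<and> v \<in> verts G \<and> u \<noteq> v \<and> share_prey (arcs_ends G) m u v" for u v
  proof (cases "u \<in> verts G \<and> v \<in> verts G")
    case True
    then show ?thesis
      unfolding share_prey_def
      using ex_awalk_length_iff[of u _ m] ex_awalk_length_iff[of v _ m] by metis
  qed auto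
  then show ?thesis unfolding step_competition_graph_def by (simp only:)
qed

text \<open>Finiteness turns the eventual constancy of every pair into a common bound; the limit
  graph joins exactly the distinct pairs that share prey from some point on.\<close>

lemma (in fin_digraph) diverges_iff_oscillates:
  "graph_seq_diverges (\<lambda>m. step_competition_graph m G) \<longleftrightarrow>
    (\<exists>u\<in>verts G. \<exists>v\<in>verts G. u \<noteq> v \<and> oscillates (\<lambda>n. share_prey (arcs_ends G) n u v))"
  (is "?L \<longleftrightarrow> ?R")
proof
  assume ?R
  then obtain u v where uv: "u \<in> verts G" "v \<in> verts G" "u \<noteq> v"
    and osc: "oscillates (\<lambda>n. share_prey (arcs_ends G) n u v)" by blast
  show ?L unfolding graph_seq_diverges_def graph_seq_converges_to_def
  proof (intro notI, elim exE)
    fix H N assume H: "\<forall>m\<ge>N. step_competition_graph m G = H"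
    have "share_prey (arcs_ends G) m u v \<longleftrightarrow> (u, v) \<in> parcs H" if "m \<ge> N" for m
      using H that uv by (force simp: step_competition_graph_conv)
    then show False using osc unfolding oscillates_def INFM_nat_le by blast
  qed
next
  assume L: ?L
  show ?R
  proof (rule ccontr)
    assume not_R: "\<not> ?R"
    define P where "P u v n \<longleftrightarrow> share_prey (arcs_ends G) n u v" for u v n
    \<comment> \<open>Only distinct vertices are known not to oscillate, hence the premise
      \<open>u \<noteq> v\<close> inside.\<close>
    have *: "\<forall>\<^sub>\<infinity>n. u \<noteq> v \<longrightarrow> (P u v n \<longleftrightarrow> (\<forall>\<^sub>\<infinity>n. P u v n))" if "u \<in> verts G" "v \<in> verts G" for u v
    proof (cases "u = v")
      case False
      then have "\<not> oscillates (P u v)" using not_R that unfolding P_def by auto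
      then have "(\<forall>\<^sub>\<infinity>n. P u v n) \<or> (\<forall>\<^sub>\<infinity>n. \<not> P u v n)" by (auto simp: oscillates_def)
      then show ?thesis
      proof
        assume *: "\<forall>\<^sub>\<infinity>n. \<not> P u v n"
        have "\<not> (\<forall>\<^sub>\<infinity>n. P u v n)"
        proof
          assume "\<forall>\<^sub>\<infinity>n. P u v n"
          with * have "\<forall>\<^sub>\<infinity>n. \<not> P u v n \<and> P u v n" by (rule eventually_conj)
          then show False by simp
        qed
        then show ?thesis using * by (elim MOST_mono) blast
      next
        assume *: "\<forall>\<^sub>\<infinity>n. P u v n"
        then show ?thesis by (auto elim: MOST_mono)
      qed
    qed simp
    have "\<forall>\<^sub>\<infinity>n. \<forall>u\<in>verts G. \<forall>v\<in>verts G. u \<noteq> v \<longrightarrow> (P u v n \<longleftrightarrow> (\<forall>\<^sub>\<infinity>n. P u v n))"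
      by (intro eventually_ball_finite finite_verts ballI) (rule *)
    then obtain N where N: "\<forall>n\<ge>N. \<forall>u\<in>verts G. \<forall>v\<in>verts G. u \<noteq> v \<longrightarrow> (P u v n \<longleftrightarrow> (\<forall>\<^sub>\<infinity>n. P u v n))"
      unfolding MOST_nat_le by blast
    have "step_competition_graph n G = \<lparr> pverts = verts G,
        parcs = {(u, v). u \<in> verts G \<and> v \<in> verts G \<and> u \<noteq> v \<and> (\<forall>\<^sub>\<infinity>n. P u v n)} \<rparr>" if "n \<ge> N" for n
      using N that unfolding step_competition_graph_conv P_def by auto
    then show False using L unfolding graph_seq_diverges_def graph_seq_converges_to_def by blast
  qed
qed

lemma (in wf_digraph) imprimitivity_index_conv:
  "imprimitivity_index G = Gcd {n. 0 < n \<and> (\<exists>u. (u, u) \<in> arcs_ends G ^^ n)}"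
proof -
  have "(\<exists>p. closed_w p \<and> length p = n) \<longleftrightarrow> 0 < n \<and> (\<exists>u. (u, u) \<in> arcs_ends G ^^ n)" for n
  proof
    assume "\<exists>p. closed_w p \<and> length p = n"
    then obtain u p where p: "awalk u p u" "length p = n" "0 < n" by (auto simp: closed_w_def)
    then have "u \<in> verts G" by auto
    then show "0 < n \<and> (\<exists>u. (u, u) \<in> arcs_ends G ^^ n)"
      using ex_awalk_length_iff[of u u n] p by blast
  next
    assume "0 < n \<and> (\<exists>u. (u, u) \<in> arcs_ends G ^^ n)"
    then obtain u where u: "0 < n" "(u, u) \<in> arcs_ends G ^^ n" by blast
    \<comment> \<open>Positive length places \<open>u\<close> in the vertex set; the power 0 relates
      every element of the type to itself.\<close>
    then have "u \<in> verts G" using arcs_ends_subset by (cases n) auto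
    then show "\<exists>p. closed_w p \<and> length p = n"
      using ex_awalk_length_iff[of u u n] u by (auto simp: closed_w_def)
  qed
  moreover have "{length p | p. closed_w p} = {n. \<exists>p. closed_w p \<and> length p = n}" by auto
  ultimately have "{length p | p. closed_w p} = {n. 0 < n \<and> (\<exists>u. (u, u) \<in> arcs_ends G ^^ n)}" by (simp only:)
  then show ?thesis by (simp only: imprimitivity_index_def)
qed

lemma induced_subgraph_arcs_ends:
  assumes "induced_subgraph H G"
  shows "arcs_ends H = arcs_ends G \<inter> verts H \<times> verts H"
  using assms by (auto simp: induced_subgraph_def arcs_ends_conv compatible_def)


section \<open>Partite sets and strong components as functions on vertices\<close>

locale multipartite_tournament_components =
  fixes D :: "('a, 'b) pre_digraph" and k s :: nat
    and V :: "nat \<Rightarrow> 'a set" and Q :: "nat \<Rightarrow> ('a, 'b) pre_digraph"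
  assumes tournament: "multipartite_tournament k V D"
    and components: "ordered_strong_components D s Q"
begin

abbreviation R where "R \<equiv> arcs_ends D"

sublocale digraph D
  using tournament by (auto simp: multipartite_tournament_def orientation_of_def)

lemma partition: "is_partition_of V k (verts D)"
  and symcl_arcs: "u \<rightarrow>\<^bsub>D\<^esub> v \<or> v \<rightarrow>\<^bsub>D\<^esub> u \<longleftrightarrow> (\<exists>i\<in>{1..k}. \<exists>j\<in>{1..k}. i \<noteq> j \<and> u \<in> V i \<and> v \<in> V j)"
proof -
  obtain G where G: "complete_multipartite_graph k V G" "mk_symmetric D = G"
    using tournament by (auto simp: multipartite_tournament_def orientation_of_def)
  then show "is_partition_of V k (verts D)"
    by (auto simp: complete_multipartite_graph_def)
  have "(u, v) \<in> parcs (mk_symmetric D) \<longleftrightarrow> u \<rightarrow>\<^bsub>D\<^esub> v \<or> v \<rightarrow>\<^bsub>D\<^esub> u"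
    by (auto simp: parcs_mk_symmetric arcs_ends_conv)
  then show "u \<rightarrow>\<^bsub>D\<^esub> v \<or> v \<rightarrow>\<^bsub>D\<^esub> u \<longleftrightarrow> (\<exists>i\<in>{1..k}. \<exists>j\<in>{1..k}. i \<noteq> j \<and> u \<in> V i \<and> v \<in> V j)"
    using G by (auto simp: complete_multipartite_graph_def)
qed

definition part :: "'a \<Rightarrow> nat" where "part v = (THE i. i \<in> {1..k} \<and> v \<in> V i)"

lemma part_eqI: "i \<in> {1..k} \<Longrightarrow> v \<in> V i \<Longrightarrow> part v = i"
  unfolding part_def using partition unfolding is_partition_of_def disjoint_family_on_def
  by (intro the_equality) blast+

lemma part_of_vertex:
  assumes "v \<in> verts D"
  shows "part v \<in> {1..k}" "v \<in> V (part v)"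
proof -
  obtain i where "i \<in> {1..k}" "v \<in> V i" using assms partition unfolding is_partition_of_def by blast
  then show "part v \<in> {1..k}" "v \<in> V (part v)" using part_eqI by auto
qed

lemma in_partite_set_iff: "i \<in> {1..k} \<Longrightarrow> v \<in> verts D \<Longrightarrow> v \<in> V i \<longleftrightarrow> part v = i"
  using part_eqI part_of_vertex by auto

lemma part_neq_iff:
  assumes "u \<in> verts D" "v \<in> verts D"
  shows "part u \<noteq> part v \<longleftrightarrow> u \<rightarrow>\<^bsub>D\<^esub> v \<or> v \<rightarrow>\<^bsub>D\<^esub> u"
  unfolding symcl_arcs using assms part_eqI part_of_vertex by metis

lemma Q_in_sccs: "i \<in> {1..s} \<Longrightarrow> Q i \<in> sccs"
  using components by (auto simp: ordered_strong_components_def bij_betw_def)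

lemma Q_induced: "i \<in> {1..s} \<Longrightarrow> induced_subgraph (Q i) D"
  using Q_in_sccs in_sccs_imp_induced by blast

lemma Q_strongly_connected: "i \<in> {1..s} \<Longrightarrow> strongly_connected (Q i)"
  using Q_in_sccs by blast

lemma Q_verts_subset: "i \<in> {1..s} \<Longrightarrow> verts (Q i) \<subseteq> verts D"
  using Q_induced by (auto simp: induced_subgraph_def subgraph_def)

lemma Q_nonempty: "i \<in> {1..s} \<Longrightarrow> verts (Q i) \<noteq> {}"
  using Q_strongly_connected by (auto simp: strongly_connected_def)

lemma Q_eqI:
  assumes "i \<in> {1..s}" "j \<in> {1..s}" "v \<in> verts (Q i)" "v \<in> verts (Q j)"
  shows "i = j"
proof -
  have "verts (Q i) = verts (Q j)"
    using sccs_verts_disjoint[of "verts (Q i)" "verts (Q j)"] assms Q_in_sccs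
    unfolding sccs_verts_conv by blast
  then have "Q i = Q j" using inj_on_verts_sccs assms(1,2) Q_in_sccs by (meson inj_onD)
  then show ?thesis using components assms(1,2)
    by (auto simp: ordered_strong_components_def bij_betw_def dest: inj_onD)
qed

definition idx :: "'a \<Rightarrow> nat" where "idx v = (THE i. i \<in> {1..s} \<and> v \<in> verts (Q i))"

lemma idx_eqI: "i \<in> {1..s} \<Longrightarrow> v \<in> verts (Q i) \<Longrightarrow> idx v = i"
  unfolding idx_def using Q_eqI by (intro the_equality) blast+

lemma idx_of_vertex:
  assumes "v \<in> verts D"
  shows "idx v \<in> {1..s}" "v \<in> verts (Q (idx v))"
proof -
  have "scc_of v \<in> verts ` sccs" using scc_of_in_sccs_verts[OF assms] sccs_verts_conv by simp
  moreover have "sccs = Q ` {1..s}"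
    using components by (auto simp: ordered_strong_components_def bij_betw_def)
  moreover have "v \<in> scc_of v" using assms by (auto simp: scc_of_def)
  ultimately obtain i where "i \<in> {1..s}" "v \<in> verts (Q i)" by auto
  then show "idx v \<in> {1..s}" "v \<in> verts (Q (idx v))" using idx_eqI by auto
qed

lemma in_component_iff: "i \<in> {1..s} \<Longrightarrow> v \<in> verts (Q i) \<longleftrightarrow> v \<in> verts D \<and> idx v = i"
  using idx_eqI idx_of_vertex Q_verts_subset by blast

lemma idx_arc_le:
  assumes "u \<rightarrow>\<^bsub>D\<^esub> v"
  shows "idx u \<le> idx v"
proof -
  have "u \<in> verts D" "v \<in> verts D" using assms arcs_ends_subset by blast+
  then show ?thesis
    using components idx_of_vertex[of u] idx_of_vertex[of v] assms
    by (meson leI ordered_strong_components_def)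
qed

text \<open>After component \<open>t\<close> every component is a single vertex and there are no
  loops, so each arc leads to a strictly later component. This is used with the last nontrivial
  \<open>t\<close> for the tail, and with \<open>t = 0\<close> if no component is
  nontrivial.\<close>

lemma idx_walk_bound:
  assumes trivial: "\<And>i. i \<in> {1..s} \<Longrightarrow> t < i \<Longrightarrow> \<not> nontrivial_component (Q i)"
    and "(x, y) \<in> R ^^ m" "x \<in> verts D" "t < idx x"
  shows "y \<in> verts D \<and> idx x + m \<le> idx y"
  using assms(2)
proof (induction m arbitrary: y)
  case 0
  then show ?case using assms(3) by auto
next
  case (Suc m)
  then obtain z where z: "(x, z) \<in> R ^^ m" "(z, y) \<in> R" by auto
  then have verts: "z \<in> verts D" "y \<in> verts D" using arcs_ends_subset by blast+
  have IH: "idx x + m \<le> idx z" using Suc.IH[OF z(1)] by blast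
  have "idx z \<noteq> idx y"
  proof
    assume "idx z = idx y"
    then have "{z, y} \<subseteq> verts (Q (idx z))"
      using idx_of_vertex(2)[OF verts(1)] idx_of_vertex(2)[OF verts(2)] by simp
    moreover have "card (verts (Q (idx z))) = 1"
      using trivial[of "idx z"] idx_of_vertex(1)[OF verts(1)] IH assms(4)
      by (auto simp: nontrivial_component_def)
    ultimately have "z = y" by (auto simp: card_1_singleton_iff)
    then show False using z(2) adj_not_same by blast
  qed
  then show ?case using idx_arc_le[OF z(2)] IH verts by linarith
qed

lemma acyclic_not_oscillates:
  assumes "\<not> (\<exists>C\<in>sccs. nontrivial_component C)" "u \<in> verts D"
  shows "\<not> oscillates (\<lambda>n. share_prey R n u v)"
proof -
  have "\<not> share_prey R n u v" if "s < n" for n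
  proof
    assume "share_prey R n u v"
    then obtain w where "(u, w) \<in> R ^^ n" by (auto simp: share_prey_def)
    then have "w \<in> verts D \<and> idx u + n \<le> idx w"
      using idx_walk_bound[of 0 u w n] assms Q_in_sccs idx_of_vertex(1)[of u] by auto
    then show False using idx_of_vertex(1)[of w] that by auto
  qed
  then show ?thesis by (auto simp: oscillates_def INFM_nat)
qed

end

section \<open>The last nontrivial component as core\<close>

locale multipartite_tournament_last_component = multipartite_tournament_components +
  fixes t :: nat
  assumes last: "last_nontrivial_component s Q t"
begin

abbreviation "B \<equiv> {v \<in> verts D. idx v < t}"
abbreviation "C \<equiv> verts (Q t)"
abbreviation "T \<equiv> {v \<in> verts D. t < idx v}"

lemma t: "t \<in> {1..s}"
  using last by (simp add: last_nontrivial_component_def)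

lemma C_conv: "C = {v \<in> verts D. idx v = t}"
  using in_component_iff t by auto

lemma verts_conv: "B \<union> C \<union> T = verts D"
  unfolding C_conv by auto

lemma core_arcs_ends: "arcs_ends (Q t) = R \<inter> C \<times> C"
  using induced_subgraph_arcs_ends[OF Q_induced[OF t]] .

sublocale tournament_with_core R B C T part
proof unfold_locales
  show "R \<subseteq> (B \<union> C \<union> T) \<times> (B \<union> C \<union> T)" unfolding verts_conv using arcs_ends_subset .
  show "B \<inter> C = {}" "B \<inter> T = {}" "C \<inter> T = {}" unfolding C_conv by auto
  show "part x \<noteq> part y \<longleftrightarrow> (x, y) \<in> R \<or> (y, x) \<in> R" if "x \<in> B \<union> C \<union> T" "y \<in> B \<union> C \<union> T" for x y
    using part_neq_iff that unfolding verts_conv by blast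
  show "y \<in> C \<union> T" if "(x, y) \<in> R" "x \<in> C" for x y
    using idx_arc_le[OF that(1)] that arcs_ends_subset unfolding C_conv by auto
  show "y \<in> T" if "(x, y) \<in> R" "x \<in> T" for x y
    using idx_arc_le[OF that(1)] that arcs_ends_subset by auto
  \<comment> \<open>The bound is \<open>s\<close>: each step in the tail raises the component index,
    which is at most \<open>s\<close>.\<close>
  show "\<exists>N. \<forall>x y m. x \<in> T \<longrightarrow> (x, y) \<in> R ^^ m \<longrightarrow> m \<le> N"
  proof (intro exI allI impI)
    fix x y m assume "x \<in> T" "(x, y) \<in> R ^^ m"
    then have "y \<in> verts D \<and> idx x + m \<le> idx y"
      using idx_walk_bound[of t x y m] last by (auto simp: last_nontrivial_component_def)
    then show "m \<le> s" using idx_of_vertex(1)[of y] by auto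
  qed
  show "(x, y) \<in> (R \<inter> C \<times> C)\<^sup>*" if "x \<in> C" "y \<in> C" for x y
    using Q_strongly_connected[OF t] that rtrancl_on_sub_rtrancl
    unfolding strongly_connected_def reachable_def core_arcs_ends by blast
  have "card C \<noteq> 1" using last by (simp add: last_nontrivial_component_def nontrivial_component_def)
  moreover obtain x where x: "x \<in> C" using Q_nonempty[OF t] by blast
  ultimately have "C \<noteq> {x}" by auto
  then show "\<exists>x\<in>C. \<exists>y\<in>C. x \<noteq> y" using x by auto
qed

lemma index_conv: "imprimitivity_index (Q t) = Gcd {n. 0 < n \<and> (\<exists>u. (u, u) \<in> (R \<inter> C \<times> C) ^^ n)}"
proof -
  interpret core: wf_digraph "Q t" using Q_induced[OF t] by (rule wf_digraphI_induced)
  show ?thesis using core.imprimitivity_index_conv unfolding core_arcs_ends .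
qed

lemma T_conv: "T = (\<Union>i\<in>{t+1..s}. verts (Q i))"
proof (intro equalityI subsetI)
  fix v assume "v \<in> T"
  then show "v \<in> (\<Union>i\<in>{t+1..s}. verts (Q i))" using idx_of_vertex[of v] by auto
next
  fix v assume "v \<in> (\<Union>i\<in>{t+1..s}. verts (Q i))"
  then obtain i where "i \<in> {t+1..s}" "v \<in> verts (Q i)" by auto
  then show "v \<in> T" using in_component_iff[of i v] by auto
qed

lemma converges_if:
  assumes "\<And>u v. u \<in> B \<union> C \<union> T \<Longrightarrow> v \<in> B \<union> C \<union> T \<Longrightarrow> \<not> oscillates (\<lambda>n. share_prey R n u v)"
  shows "\<not> graph_seq_diverges (\<lambda>m. step_competition_graph m D)"
  using assms unfolding diverges_iff_oscillates verts_conv by blast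

lemma T_nonempty_iff: "T \<noteq> {} \<longleftrightarrow> t < s"
  unfolding T_conv using Q_nonempty[of s] by force

lemma component_range_conv:
  assumes "t < i" "j \<le> s"
  shows "verts (component_range D Q i j) = {v \<in> T. i \<le> idx v \<and> idx v \<le> j}"
proof -
  have "v \<in> verts (Q l) \<longleftrightarrow> v \<in> T \<and> idx v = l" if "l \<in> {i..j}" for v l
    using in_component_iff[of l v] that assms by auto
  then have "(\<Union>l\<in>{i..j}. verts (Q l)) = {v \<in> T. i \<le> idx v \<and> idx v \<le> j}" by auto
  then show ?thesis by (simp add: component_range_def)
qed

end

section \<open>Sets of imprimitivity and their labeling\<close>

locale multipartite_tournament_labeled = multipartite_tournament_last_component +
  fixes U :: "nat \<Rightarrow> 'a set"
  assumes imprimitivity: "sets_of_imprimitivity (Q t) U"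
    and labeling: "labeling_convention V (Q t) U"
begin

abbreviation "\<kappa> \<equiv> imprimitivity_index (Q t)"

definition pos :: "'a \<Rightarrow> nat" where "pos v = (THE i. i \<in> {1..\<kappa>} \<and> v \<in> U i)"

lemma pos_eqI: "i \<in> {1..\<kappa>} \<Longrightarrow> v \<in> U i \<Longrightarrow> pos v = i"
  unfolding pos_def
  using imprimitivity unfolding sets_of_imprimitivity_def is_partition_of_def disjoint_family_on_def
  by (intro the_equality) blast+

lemma pos_of_vertex:
  assumes "v \<in> C"
  shows "pos v \<in> {1..\<kappa>}" "v \<in> U (pos v)"
proof -
  obtain i where "i \<in> {1..\<kappa>}" "v \<in> U i"
    using assms imprimitivity unfolding sets_of_imprimitivity_def is_partition_of_def by blast
  then show "pos v \<in> {1..\<kappa>}" "v \<in> U (pos v)" using pos_eqI by auto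
qed

lemma U_subset: "i \<in> {1..\<kappa>} \<Longrightarrow> U i \<subseteq> C"
  using imprimitivity unfolding sets_of_imprimitivity_def is_partition_of_def by blast

lemma in_U_iff: "i \<in> {1..\<kappa>} \<Longrightarrow> v \<in> U i \<longleftrightarrow> v \<in> C \<and> pos v = i"
  using pos_eqI pos_of_vertex U_subset by blast

lemma pos_onto:
  assumes "i \<in> {1..\<kappa>}"
  shows "\<exists>x\<in>C. pos x = i"
proof -
  have "U i \<noteq> {}"
    using assms imprimitivity unfolding sets_of_imprimitivity_def is_partition_of_def by blast
  then show ?thesis using in_U_iff[OF assms] by blast
qed

lemma pos_arc:
  assumes "x \<in> C" "y \<in> C" "(x, y) \<in> R"
  shows "pos y = pos x mod \<kappa> + 1"
proof -
  have "(x, y) \<in> arcs_ends (Q t)" using assms unfolding core_arcs_ends by blast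
  then obtain i where i: "i \<in> {1..\<kappa>}" "x \<in> U i" "y \<in> U (i mod \<kappa> + 1)"
    using imprimitivity unfolding sets_of_imprimitivity_def by blast
  moreover have "i mod \<kappa> + 1 \<in> {1..\<kappa>}" using i(1) by (auto simp: Suc_le_eq)
  ultimately show ?thesis using pos_eqI by metis
qed

lemma index_cases: "\<kappa> \<in> {1, 2, 3, 4}"
proof -
  have "\<kappa> \<le> 4" using index_le_four[of \<kappa> pos] pos_onto pos_arc by blast
  moreover obtain x where "x \<in> C" using nontrivial by blast
  then have "1 \<le> \<kappa>" using pos_of_vertex(1)[of x] by simp
  ultimately show ?thesis by auto
qed

lemma C_subset: "C \<subseteq> verts D"
  unfolding C_conv by auto

text \<open>The labeling names \<open>V 1\<close> to \<open>V 3\<close> without saying that these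
  indices are at most \<open>k\<close>, beyond which \<open>V\<close> is arbitrary. A core vertex of
  class \<open>j\<close> lies in a genuine partite set; if \<open>k < j\<close>, the index of that
  set is smaller than \<open>j\<close>, which \<open>label\<close> excludes.\<close>

lemma k_ge_if_labeled:
  assumes "j \<in> {1..\<kappa>}" and label: "\<And>v i. i \<in> {1..<j} \<Longrightarrow> v \<in> C \<Longrightarrow> v \<in> V i \<Longrightarrow> pos v \<noteq> j"
  shows "j \<le> k"
proof (rule ccontr)
  assume "\<not> j \<le> k"
  obtain x where x: "x \<in> C" "pos x = j" using pos_onto[OF assms(1)] by blast
  then have "part x \<in> {1..k}" "x \<in> V (part x)" using part_of_vertex[of x] C_subset by auto
  then show False using label[of "part x" x] x \<open>\<not> j \<le> k\<close> by auto
qed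

lemma part_index_two:
  assumes \<kappa>: "\<kappa> = 2"
  shows "part ` C \<subseteq> {1, 2}"
proof -
  have V: "V i \<inter> C = U i" if "i \<in> {1, 2}" for i
    using labeling \<kappa> that unfolding labeling_convention_def by blast
  have "2 \<le> k"
  proof (rule k_ge_if_labeled)
    show "pos v \<noteq> 2" if "i \<in> {1..<2}" "v \<in> C" "v \<in> V i" for v i
    proof -
      have "i = 1" using that(1) by simp
      then have "v \<in> U 1" using V[of 1] that by blast
      then show ?thesis using pos_eqI[of 1 v] \<kappa> by simp
    qed
  qed (use \<kappa> in auto)
  moreover have "C \<subseteq> V 1 \<union> V 2" using labeling \<kappa> unfolding labeling_convention_def by blast
  ultimately show ?thesis using part_eqI[of 1] part_eqI[of 2] by force
qed

lemma index_three:
  assumes \<kappa>: "\<kappa> = 3"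
  shows "3 \<le> k" "x \<in> C \<Longrightarrow> part x = pos x"
proof -
  have V: "V i \<inter> C = U i" if "i \<in> {1, 2, 3}" for i
    using labeling \<kappa> that unfolding labeling_convention_def by blast
  show k: "3 \<le> k"
  proof (rule k_ge_if_labeled)
    show "pos v \<noteq> 3" if "i \<in> {1..<3}" "v \<in> C" "v \<in> V i" for v i
    proof -
      have i: "i \<in> {1, 2}" using that(1) by auto
      then have "v \<in> U i" using V[of i] that by blast
      then show ?thesis using pos_eqI[of i v] \<kappa> i by auto
    qed
  qed (use \<kappa> in auto)
  show "part x = pos x" if "x \<in> C" for x
  proof -
    have p: "pos x \<in> {1, 2, 3}" using pos_of_vertex(1)[OF that] \<kappa> by auto
    then have "x \<in> V (pos x)" using V[OF p] pos_of_vertex(2)[OF that] by blast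
    then show ?thesis using part_eqI p k by auto
  qed
qed

lemma index_four:
  assumes \<kappa>: "\<kappa> = 4"
  shows "2 \<le> k" "x \<in> C \<Longrightarrow> part x = (if odd (pos x) then 1 else 2)"
proof -
  have V: "V 1 \<inter> C = U 1 \<union> U 3" "V 2 \<inter> C = U 2 \<union> U 4"
    using labeling \<kappa> unfolding labeling_convention_def by (simp_all add: numeral_eq_Suc)
  show k: "2 \<le> k"
  proof (rule k_ge_if_labeled)
    show "pos v \<noteq> 2" if "i \<in> {1..<2}" "v \<in> C" "v \<in> V i" for v i
    proof -
      have "i = 1" using that(1) by simp
      then have "v \<in> U 1 \<union> U 3" using V(1) that by blast
      then show ?thesis using pos_eqI[of 1 v] pos_eqI[of 3 v] \<kappa> by auto
    qed
  qed (use \<kappa> in auto)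
  show "part x = (if odd (pos x) then 1 else 2)" if x: "x \<in> C" for x
  proof -
    have p: "pos x \<in> {1, 2, 3, 4}" using pos_of_vertex(1)[OF that] \<kappa> by auto
    then have "x \<in> V (if odd (pos x) then 1 else 2)"
      using V pos_of_vertex(2)[OF that] by auto
    then show ?thesis using part_eqI k by auto
  qed
qed

section \<open>Convergence and divergence by index\<close>

lemma empty_tail_converges:
  assumes "t = s"
  shows "\<not> graph_seq_diverges (\<lambda>m. step_competition_graph m D)"
proof -
  have "T = {}" using assms T_nonempty_iff by simp
  then show ?thesis by (rule converges_if[OF empty_tail_not_oscillates])
qed

lemma index_le_two_converges:
  assumes "\<kappa> \<in> {1, 2}"
  shows "\<not> graph_seq_diverges (\<lambda>m. step_competition_graph m D)"
  using assms
proof (elim insertE emptyE)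
  assume "\<kappa> = 1"
  then show ?thesis by (intro converges_if primitive_not_oscillates) (simp_all only: index_conv)
next
  assume \<kappa>: "\<kappa> = 2"
  then show ?thesis using part_index_two[OF \<kappa>]
    by (intro converges_if index_two_not_oscillates) (simp_all only: index_conv)
qed

lemma diverges_if_core_oscillates:
  "\<exists>x\<in>C. \<exists>y\<in>C. x \<noteq> y \<and> oscillates (\<lambda>n. share_prey R n x y) \<Longrightarrow>
    graph_seq_diverges (\<lambda>m. step_competition_graph m D)"
  using C_subset unfolding diverges_iff_oscillates by blast

lemma T_subset_partite_iff:
  assumes "j \<in> {1..k}"
  shows "(\<Union>i\<in>{t+1..s}. verts (Q i)) \<subseteq> V j \<longleftrightarrow> part ` T \<subseteq> {j}"
proof -
  have "T \<subseteq> V j \<longleftrightarrow> part ` T \<subseteq> {j}" using in_partite_set_iff[OF assms] by auto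
  then show ?thesis by (simp only: T_conv)
qed

lemma index_four_diverges_iff:
  assumes \<kappa>: "\<kappa> = 4" and "t < s"
  shows "graph_seq_diverges (\<lambda>m. step_competition_graph m D) \<longleftrightarrow>
    (\<exists>j\<in>{1,2}. (\<Union>i\<in>{t+1..s}. verts (Q i)) \<subseteq> V j)"
proof -
  note part = index_four(2)[OF \<kappa>]
  have arc: "pos y mod 4 = (pos x + 1) mod 4" if "x \<in> C" "y \<in> C" "(x, y) \<in> R" for x y
    using pos_arc[OF that] \<kappa> by (simp add: mod_simps)
  have iff: "(\<Union>i\<in>{t+1..s}. verts (Q i)) \<subseteq> V j \<longleftrightarrow> part ` T \<subseteq> {j}" if "j \<in> {1, 2}" for j
    by (rule T_subset_partite_iff) (use that index_four(1)[OF \<kappa>] in auto)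
  show ?thesis
  proof
    assume div: "graph_seq_diverges (\<lambda>m. step_competition_graph m D)"
    show "\<exists>j\<in>{1,2}. (\<Union>i\<in>{t+1..s}. verts (Q i)) \<subseteq> V j"
    proof (rule ccontr)
      assume "\<not> ?thesis"
      then have tail: "\<not> part ` T \<subseteq> {j}" if "j \<in> {1, 2}" for j
        using that unfolding iff[OF that, symmetric] by blast
      have core: "part ` C \<subseteq> {1, 2}" using part by auto
      show False using converges_if[OF index_four_not_oscillates[OF core tail]] div by simp
    qed
  next
    assume "\<exists>j\<in>{1,2}. (\<Union>i\<in>{t+1..s}. verts (Q i)) \<subseteq> V j"
    then obtain j where j: "j \<in> {1, 2}" "(\<Union>i\<in>{t+1..s}. verts (Q i)) \<subseteq> V j" ..
    have "part ` T \<subseteq> {j}" using j(2) unfolding iff[OF j(1)] .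
    moreover have "T \<noteq> {}" using T_nonempty_iff \<open>t < s\<close> by simp
    ultimately show "graph_seq_diverges (\<lambda>m. step_competition_graph m D)"
      using index_four_oscillates[OF arc part _ _ j(1)] by (intro diverges_if_core_oscillates)
  qed
qed

text \<open>
  Conditions (i) and (ii) together say that the tail lies in two cyclically consecutive partite sets
  \<open>j\<close> and \<open>j mod 3 + 1\<close>, with no arc back from the second to the first; in (i) one of them
  is not met.
\<close>

lemma index_three_conditions_iff:
  assumes \<kappa>: "\<kappa> = 3"
  shows "(\<exists>j\<in>{1,2,3}. (\<Union>i\<in>{t+1..s}. verts (Q i)) \<subseteq> V j) \<or>
      (\<exists>\<alpha>\<in>{t+1..s-1}. \<exists>j\<in>{1,2,3}.
         partite_related k V (verts (component_range D Q (t+1) \<alpha>)) (U j) \<and>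
         partite_related k V (verts (component_range D Q (\<alpha>+1) s)) (U (j mod 3 + 1))) \<longleftrightarrow>
    (\<exists>j\<in>{1,2,3}. part ` T \<subseteq> {j, j mod 3 + 1} \<and>
      (\<forall>p\<in>T. \<forall>q\<in>T. part p = j mod 3 + 1 \<longrightarrow> part q = j \<longrightarrow> (p, q) \<notin> R))"
    (is "?one \<or> ?two \<longleftrightarrow> ?forward")
proof -
  have k: "j \<in> {1..k}" if "j \<in> {1, 2, 3}" for j using that index_three(1)[OF \<kappa>] by auto
  have next3: "j mod 3 + 1 \<in> {1, 2, 3}" "j mod 3 + 1 \<noteq> j" if "j \<in> {1, 2, 3 :: nat}" for j
    using that by auto
  \<comment> \<open>\<open>U j\<close> is nonempty and contained in \<open>V j\<close>, so being
    partite-related to it can only mean inclusion in \<open>V j\<close>.\<close>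
  have related: "partite_related k V X (U j) \<longleftrightarrow> part ` X \<subseteq> {j}"
    if "j \<in> {1, 2, 3}" "X \<subseteq> verts D" for X j
  proof -
    have j: "j \<in> {1..\<kappa>}" using that(1) \<kappa> by auto
    have U: "x \<in> C" "part x = j" if "x \<in> U j" for x
      using that in_U_iff[OF j] index_three(2)[OF \<kappa>] by auto
    obtain x where "x \<in> C" "pos x = j" using pos_onto[OF j] by blast
    then have x: "x \<in> U j" "part x = j" using in_U_iff[OF j] U by auto
    have "U j \<subseteq> V j"
    proof
      fix y assume "y \<in> U j"
      then show "y \<in> V j" using U[of y] part_of_vertex(2)[of y] C_subset by auto
    qed
    then have "partite_related k V X (U j) \<longleftrightarrow> X \<subseteq> V j"
      using x part_eqI k[OF that(1)] unfolding partite_related_def by blast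
    also have "\<dots> \<longleftrightarrow> part ` X \<subseteq> {j}" using in_partite_set_iff[OF k[OF that(1)]] that(2) by auto
    finally show ?thesis .
  qed
  have one_iff: "?one \<longleftrightarrow> (\<exists>j\<in>{1,2,3}. part ` T \<subseteq> {j})"
    by (intro bex_cong refl T_subset_partite_iff k)
  have two_iff: "?two \<longleftrightarrow> (\<exists>\<alpha>\<in>{t+1..s-1}. \<exists>j\<in>{1,2,3}.
      \<forall>v\<in>T. part v = (if idx v \<le> \<alpha> then j else j mod 3 + 1))"
  proof (intro bex_cong refl)
    fix \<alpha> j assume \<alpha>: "\<alpha> \<in> {t+1..s-1}" and j: "j \<in> {1, 2, 3 :: nat}"
    have low: "verts (component_range D Q (t+1) \<alpha>) = {v \<in> T. idx v \<le> \<alpha>}"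
      using component_range_conv[of "t+1" \<alpha>] \<alpha> by auto
    have high: "verts (component_range D Q (\<alpha>+1) s) = {v \<in> T. \<not> idx v \<le> \<alpha>}"
      using component_range_conv[of "\<alpha>+1" s] \<alpha> idx_of_vertex(1) by auto
    show "partite_related k V (verts (component_range D Q (t+1) \<alpha>)) (U j) \<and>
        partite_related k V (verts (component_range D Q (\<alpha>+1) s)) (U (j mod 3 + 1)) \<longleftrightarrow>
      (\<forall>v\<in>T. part v = (if idx v \<le> \<alpha> then j else j mod 3 + 1))"
      unfolding low high using related[OF j] related[OF next3(1)[OF j]] by auto
  qed
  show ?thesis
  proof
    assume "?one \<or> ?two"
    then show ?forward
    proof
      assume ?one
      then obtain j where j: "j \<in> {1, 2, 3}" "part ` T \<subseteq> {j}" unfolding one_iff by blast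
      \<comment> \<open>The set \<open>j mod 3 + 1\<close> is not met, so no arc back can start
        there.\<close>
      then have "\<forall>p\<in>T. part p \<noteq> j mod 3 + 1" using next3(2)[OF j(1)] by auto
      then show ?forward using j by blast
    next
      assume ?two
      then obtain \<alpha> j where j: "j \<in> {1, 2, 3}"
        and part: "\<And>v. v \<in> T \<Longrightarrow> part v = (if idx v \<le> \<alpha> then j else j mod 3 + 1)"
        unfolding two_iff by blast
      have "(p, q) \<notin> R" if "p \<in> T" "q \<in> T" "part p = j mod 3 + 1" "part q = j" for p q
        using that part[of p] part[of q] idx_arc_le[of p q] next3(2)[OF j]
        by (auto split: if_splits)
      moreover have "part ` T \<subseteq> {j, j mod 3 + 1}" using part by auto
      ultimately show ?forward using j by blast
    qed
  next
    assume ?forward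
    then obtain j where j: "j \<in> {1, 2, 3}" "part ` T \<subseteq> {j, j mod 3 + 1}"
      and *: "\<forall>p\<in>T. \<forall>q\<in>T. part p = j mod 3 + 1 \<longrightarrow> part q = j \<longrightarrow> (p, q) \<notin> R"
      by (elim bexE conjE)
    have forward: "(p, q) \<notin> R" if "p \<in> T" "q \<in> T" "part p = j mod 3 + 1" "part q = j" for p q
      using * that by blast
    show "?one \<or> ?two"
    proof (cases "part ` T \<subseteq> {j} \<or> part ` T \<subseteq> {j mod 3 + 1}")
      case True
      then show ?thesis using j(1) next3(1)[OF j(1)] unfolding one_iff by blast
    next
      case False
      define L where "L = {v \<in> T. part v = j}"
      \<comment> \<open>The last component index of a tail vertex in set \<open>j\<close>. Both sets
        are met in this case, so it exists, and a vertex of the other set comes later, which gives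
        \<open>\<alpha> \<le> s - 1\<close>.\<close>
      define \<alpha> where "\<alpha> = Max (idx ` L)"
      have L: "finite L" "L \<noteq> {}" using False j(2) unfolding L_def by auto
      \<comment> \<open>Vertices of the two sets are adjacent and no arc leads back, so the arc goes
        forward, to a strictly later component because tail components are single vertices.\<close>
      have less: "idx p < idx q" if "p \<in> L" "q \<in> T" "part q = j mod 3 + 1" for p q
      proof -
        have p: "p \<in> T" "part p = j" using that(1) by (auto simp: L_def)
        then have "part p \<noteq> part q" using that(3) next3(2)[OF j(1)] by simp
        then have "(p, q) \<in> R" using forward[OF that(2) p(1) that(3) p(2)] adjacent that(2) p(1) by blast
        then have "(p, q) \<in> R ^^ 1" by simp
        then have "idx p + 1 \<le> idx q"
          using idx_walk_bound[of t p q 1] p(1) last by (auto simp: last_nontrivial_component_def)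
        then show ?thesis by simp
      qed
      have "\<alpha> \<in> idx ` L" unfolding \<alpha>_def using L by (intro Max_in) auto
      then obtain p where p: "p \<in> L" "idx p = \<alpha>" by auto
      obtain q where q: "q \<in> T" "part q = j mod 3 + 1" using False j(2) by blast
      have "\<alpha> < idx q" using less[OF p(1) q] p(2) by simp
      then have \<alpha>: "\<alpha> \<in> {t+1..s-1}" using p q(1) idx_of_vertex(1)[of q] by (auto simp: L_def)
      have "part v = (if idx v \<le> \<alpha> then j else j mod 3 + 1)" if v: "v \<in> T" for v
      proof (cases "part v = j")
        case True
        then have "idx v \<le> \<alpha>" using v L(1) unfolding \<alpha>_def by (intro Max_ge) (auto simp: L_def)
        then show ?thesis using True by simp
      next
        case False
        then have "part v = j mod 3 + 1" using v j(2) by blast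
        then show ?thesis using less[OF p(1) v] p(2) by simp
      qed
      then show ?thesis using \<alpha> j(1) unfolding two_iff by blast
    qed
  qed
qed

lemma index_three_diverges_iff:
  assumes \<kappa>: "\<kappa> = 3" and "t < s"
  shows "graph_seq_diverges (\<lambda>m. step_competition_graph m D) \<longleftrightarrow>
    (\<exists>j\<in>{1,2,3}. part ` T \<subseteq> {j, j mod 3 + 1} \<and>
      (\<forall>p\<in>T. \<forall>q\<in>T. part p = j mod 3 + 1 \<longrightarrow> part q = j \<longrightarrow> (p, q) \<notin> R))"
    (is "?div \<longleftrightarrow> ?forward")
proof -
  have core: "part ` C \<subseteq> {1, 2, 3}"
    using index_three(2)[OF \<kappa>] pos_of_vertex(1) \<kappa> by force
  have rotate: "part y = part x mod 3 + 1" if "x \<in> C" "y \<in> C" "(x, y) \<in> R" for x y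
    using pos_arc[OF that] index_three(2)[OF \<kappa>] that \<kappa> by simp
  show ?thesis
  proof
    assume ?div
    show ?forward
    proof (rule ccontr)
      assume "\<not> ?forward"
      then have tail: "\<exists>p\<in>T. \<exists>q\<in>T. part p = j mod 3 + 1 \<and> part q = j \<and> (p, q) \<in> R"
        if "j \<in> {1, 2, 3}" "part ` T \<subseteq> {j, j mod 3 + 1}" for j
        using that by meson
      show False using converges_if[OF index_three_not_oscillates[OF core rotate tail]] \<open>?div\<close> by simp
    qed
  next
    assume ?forward
    then obtain j where j: "j \<in> {1, 2, 3}" "part ` T \<subseteq> {j, j mod 3 + 1}"
      and *: "\<forall>p\<in>T. \<forall>q\<in>T. part p = j mod 3 + 1 \<longrightarrow> part q = j \<longrightarrow> (p, q) \<notin> R"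
      by (elim bexE conjE)
    have forward: "(p, q) \<notin> R" if "p \<in> T" "q \<in> T" "part p = j mod 3 + 1" "part q = j" for p q
      using * that by blast
    have "T \<noteq> {}" using T_nonempty_iff \<open>t < s\<close> by simp
    then show ?div
      using index_three_oscillates[OF core rotate _ j forward] by (intro diverges_if_core_oscillates)
  qed
qed

end



theorem theorem1p2:
  fixes D :: "('a, 'b) pre_digraph"
    and k s t :: nat
    and V U :: "nat \<Rightarrow> 'a set"
    and Q :: "nat \<Rightarrow> ('a, 'b) pre_digraph"
  assumes "multipartite_tournament k V D"
    and "ordered_strong_components D s Q"
    and "(\<exists>C\<in>pre_digraph.sccs D. nontrivial_component C) \<Longrightarrow>
           last_nontrivial_component s Q t \<and>
           sets_of_imprimitivity (Q t) U \<and>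
           labeling_convention V (Q t) U"
  shows "graph_seq_diverges (\<lambda>m. step_competition_graph m D) \<longleftrightarrow>
    s \<ge> 2 \<and>
    (\<exists>C\<in>pre_digraph.sccs D. nontrivial_component C) \<and>
    t < s \<and>
    ((imprimitivity_index (Q t) = 3 \<and>
        (\<exists>j\<in>{1,2,3}. (\<Union>i\<in>{t+1..s}. verts (Q i)) \<subseteq> V j)) \<or>
     (imprimitivity_index (Q t) = 3 \<and>
        (\<exists>\<alpha>\<in>{t+1..s-1}. \<exists>j\<in>{1,2,3}.
           partite_related k V (verts (component_range D Q (t+1) \<alpha>)) (U j) \<and>
           partite_related k V (verts (component_range D Q (\<alpha>+1) s)) (U (j mod 3 + 1)))) \<or>
     (imprimitivity_index (Q t) = 4 \<and>
        (\<exists>j\<in>{1,2}. (\<Union>i\<in>{t+1..s}. verts (Q i)) \<subseteq> V j)))"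
proof -
  interpret multipartite_tournament_components D k s V Q
    using assms(1,2) by unfold_locales
  show ?thesis
  proof (cases "\<exists>C\<in>sccs. nontrivial_component C")
    case False
    \<comment> \<open>Without a nontrivial component all walks have bounded length, so both sides
      are false.\<close>
    then show ?thesis using acyclic_not_oscillates unfolding diverges_iff_oscillates by blast
  next
    case True
    interpret multipartite_tournament_labeled D k s V Q t U
      using assms(3)[OF True] by unfold_locales auto
    have "1 \<le> t" "t \<le> s" using t by auto
    show ?thesis
    proof (cases "t < s")
      case False
      then show ?thesis using empty_tail_converges \<open>t \<le> s\<close> by simp
    next
      case tail: True
      \<comment> \<open>Condition (a) follows from \<open>1 \<le> t\<close> and
        \<open>t < s\<close>.\<close>
      have "2 \<le> s" using tail \<open>1 \<le> t\<close> by simp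
      consider "\<kappa> \<in> {1, 2}" | "\<kappa> = 3" | "\<kappa> = 4" using index_cases by auto
      then show ?thesis
      proof cases
        case 1
        then have "\<kappa> \<noteq> 3" "\<kappa> \<noteq> 4" by auto
        then show ?thesis using index_le_two_converges[OF 1] by blast
      next
        case 2
        then have "\<kappa> \<noteq> 4" by simp
        then show ?thesis
          using True tail \<open>2 \<le> s\<close> 2 index_three_diverges_iff[OF 2 tail]
          unfolding index_three_conditions_iff[OF 2, symmetric] by argo
      next
        case 3
        then have "\<kappa> \<noteq> 3" by simp
        then show ?thesis
          using True tail \<open>2 \<le> s\<close> 3 index_four_diverges_iff[OF 3 tail] by argo
      qed
    qed
  qed
qed

end
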